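(* Let $X_1,X_2,\dots$ be iid real random variables with continuous cdf $F$, let $R(x)=-\log(1-F(x))$, and suppose there exist $a_r>0$, $b_r\in\mathbb R$ and $\gamma\in\mathbb R$ such that $$rR(a_rx-b_r)\to g_\gamma(x)\quad(r\to\infty),\qquad x\in\mathrm{supp}_\gamma.$$ For $n\ge r$ let $M_n^{(r)}$ be the $r$-th largest of $X_1,\dots,X_n$. Then, in the sense of weak convergence in $\mathbb R^\infty$, $$\Bigl(\frac{M_{r+j}^{(r)}+b_r}{a_r},\ j\ge 0\Bigr)\Rightarrow\bigl(g_\gamma^{\leftarrow}(\Gamma_l),\ l\ge1\bigr)\qquad(r\to\infty),$$ where $\{\Gamma_l,\,l\ge1\}$ are the (increasingly ordered) points of a homogeneous Poisson process of rate $1$ on $\mathbb R_+$.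
   Context: For $\gamma\in\mathbb R$, $\mathrm{supp}_\gamma=\{x\in\mathbb R:1-\gamma x>0\}$, and $g_\gamma:\mathrm{supp}_\gamma\to(0,\infty)$ is $g_\gamma(x)=-\log G_\gamma(-x)$, where $G_\gamma(x)=\exp\{-(1+\gamma x)^{-1/\gamma}\}$, $1+\gamma x>0$, is the extreme value distribution for maxima; that is, $g_\gamma(x)=(1-\gamma x)^{-1/\gamma}$ for $\gamma\ne0$ and $g_0(x)=e^x$. $g_\gamma^\leftarrow:(0,\infty)\to\mathrm{supp}_\gamma$ is its inverse. The points may be realized as $\Gamma_l=\sum_{i=1}^l E_i$ with $E_i$ iid standard exponential. $R(x)=+\infty$ where $F(x)=1$. The displayed convergence is the domain of attraction condition for minima: the paper assumes $rR(a_rx-b_r)\to g(x)$ for a nondecreasing $g$ with more than one point of increase, which, up to a choice of the normalizing constants, forces $g=g_\gamma$ for some $\gamma$. $\mathbb R^\infty$ carries the product topology. *)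

theory Defs
  imports "HOL-Probability.Probability"
begin

definition evd_max :: "real \<Rightarrow> real \<Rightarrow> real" where
  "evd_max \<gamma> x =
     (if \<gamma> = 0 then exp (- exp (- x)) else exp (- ((1 + \<gamma> * x) powr (- 1 / \<gamma>))))"

definition evd_supp :: "real \<Rightarrow> real set" where
  "evd_supp \<gamma> = {x. 1 - \<gamma> * x > 0}"

definition evd_g :: "real \<Rightarrow> real \<Rightarrow> real" where
  "evd_g \<gamma> x = - ln (evd_max \<gamma> (- x))"

definition evd_g_inv :: "real \<Rightarrow> real \<Rightarrow> real" where
  "evd_g_inv \<gamma> = inv_into (evd_supp \<gamma>) (evd_g \<gamma>)"

lemma evd_g_nonzero: "\<gamma> \<noteq> 0 \<Longrightarrow> evd_g \<gamma> x = (1 - \<gamma> * x) powr (- 1 / \<gamma>)"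
  by (simp add: evd_g_def evd_max_def)

lemma evd_g_zero: "evd_g 0 x = exp x"
  by (simp add: evd_g_def evd_max_def)

lemma bij_betw_evd_g: "bij_betw (evd_g \<gamma>) (evd_supp \<gamma>) {0<..}"
proof (cases "\<gamma> = 0")
  case True
  show ?thesis
    unfolding True
    by (rule bij_betwI[where g = ln]) (auto simp: evd_g_zero evd_supp_def)
next
  case False
  show ?thesis
  proof (rule bij_betwI[where g = "\<lambda>y. (1 - y powr (- \<gamma>)) / \<gamma>"])
    show "evd_g \<gamma> \<in> evd_supp \<gamma> \<rightarrow> {0<..}"
      using False by (auto simp: evd_g_nonzero evd_supp_def)
    show "(\<lambda>y. (1 - y powr (- \<gamma>)) / \<gamma>) \<in> {0<..} \<rightarrow> evd_supp \<gamma>"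
      using False by (auto simp: evd_supp_def)
    show "(1 - evd_g \<gamma> x powr (- \<gamma>)) / \<gamma> = x" if "x \<in> evd_supp \<gamma>" for x
      using False that by (simp add: evd_g_nonzero evd_supp_def powr_powr)
    show "evd_g \<gamma> ((1 - y powr (- \<gamma>)) / \<gamma>) = y" if "y \<in> {0<..}" for y
      using False that by (simp add: evd_g_nonzero powr_powr)
  qed
qed

(* R = - log (1 - F); extended-real valued because it is infinite where F = 1,
   whereas ln 0 = 0 on the reals. *)
definition cum_hazard :: "(real \<Rightarrow> real) \<Rightarrow> real \<Rightarrow> ereal" where
  "cum_hazard F x = (if F x = 1 then \<infinity> else ereal (- ln (1 - F x)))"

(* The r-th largest, counted with multiplicity, of X 1 \<omega>, ..., X n \<omega>;
   meaningful for 1 \<le> r \<le> n. *)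
definition rth_largest :: "(nat \<Rightarrow> 'a \<Rightarrow> real) \<Rightarrow> nat \<Rightarrow> nat \<Rightarrow> 'a \<Rightarrow> real" where
  "rth_largest X r n \<omega> = rev (sort (map (\<lambda>i. X i \<omega>) [1..<Suc n])) ! (r - 1)"

(* Weak convergence of Borel measures on a topological space. The library's weak_conv_m is
   restricted to measures on the real line. *)
definition weak_conv_borel ::
    "(nat \<Rightarrow> 'a::topological_space measure) \<Rightarrow> 'a measure \<Rightarrow> bool" where
  "weak_conv_borel \<mu> \<nu> \<longleftrightarrow>
     (\<forall>f :: 'a \<Rightarrow> real. continuous_on UNIV f \<and> bounded (range f) \<longrightarrow>
        (\<lambda>n. integral\<^sup>L (\<mu> n) f) \<longlonglongrightarrow> integral\<^sup>L \<nu> f)"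

(* Only the \<Gamma> l with l \<ge> 1 count as points. *)
definition count_points :: "(nat \<Rightarrow> 'b \<Rightarrow> real) \<Rightarrow> real set \<Rightarrow> 'b \<Rightarrow> nat" where
  "count_points \<Gamma> B \<omega> = card {l. 1 \<le> l \<and> \<Gamma> l \<omega> \<in> B}"

(* \<Gamma> 1 \<le> \<Gamma> 2 \<le> ... are the points of a homogeneous Poisson process on [0, \<infinity>).
   The points are locally finite, so that card in count_points never sees an infinite set
   (almost surely) when B is bounded. The Poisson probabilities are written out because
   poisson_pmf is only available for positive parameter, whereas B may be a null set. *)
definition poisson_process_points :: "'b measure \<Rightarrow> real \<Rightarrow> (nat \<Rightarrow> 'b \<Rightarrow> real) \<Rightarrow> bool" where
  "poisson_process_points N c \<Gamma> \<longleftrightarrow>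
     prob_space N \<and>
     (\<forall>l\<ge>1. \<Gamma> l \<in> borel_measurable N) \<and>
     (AE \<omega> in N. \<forall>l\<ge>1. 0 \<le> \<Gamma> l \<omega> \<and> \<Gamma> l \<omega> \<le> \<Gamma> (Suc l) \<omega>) \<and>
     (AE \<omega> in N. \<forall>t. finite {l. 1 \<le> l \<and> \<Gamma> l \<omega> \<le> t}) \<and>
     (\<forall>B\<in>sets borel. bounded B \<and> B \<subseteq> {0..} \<longrightarrow>
        (\<forall>k. measure N {\<omega> \<in> space N. count_points \<Gamma> B \<omega> = k} =
           (c * measure lborel B) ^ k / fact k * exp (- (c * measure lborel B)))) \<and>
     (\<forall>(n::nat) B. (\<forall>i<n. B i \<in> sets borel \<and> bounded (B i) \<and> B i \<subseteq> {0..}) \<and>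
          disjoint_family_on B {..<n} \<longrightarrow>
        prob_space.indep_vars N (\<lambda>_. count_space UNIV) (\<lambda>i. count_points \<Gamma> (B i)) {..<n})"

end

theory Submission
  imports Defs
begin

text \<open>
The \<open>r\<close>-th largest of \<open>r + j\<close> observations is their \<open>(j + 1)\<close>-th smallest, so the theorem is about the
smallest observations of a large sample. Under the norming \<open>x \<mapsto> (x + b\<^sub>r) / a\<^sub>r\<close> the expected number of the
first \<open>r\<close> observations up to level \<open>x\<close> tends to \<open>g\<^sub>\<gamma> x\<close>; each observation is there with small probability,
so the normed sample looks, at low levels, like a Poisson process with mean measure \<open>g\<^sub>\<gamma>\<close>. The map \<open>g\<^sub>\<gamma>\<close>
carries that process to the homogeneous one with points \<open>\<Gamma>\<^sub>l\<close>, which gives the ordered points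
\<open>g\<^sub>\<gamma>\<^sup>\<leftarrow> \<Gamma>\<^sub>l\<close> in the limit.

The proof compares explicit probabilities of finitely many \<^emph>\<open>boxes\<close>
\<open>u\<^sub>i < z\<^sub>i \<le> v\<^sub>i\<close> \<open>(i < m)\<close>, \<open>u\<^sub>m < z\<^sub>m\<close> with interlaced levels \<open>u\<^sub>0 < v\<^sub>0 \<le> u\<^sub>1 < v\<^sub>1 \<le> \<dots> \<le> u\<^sub>m\<close>. For ordered points,
lying in such a box means having exactly one point in each cell \<open>(u\<^sub>i, v\<^sub>i]\<close> and no further point up to \<open>u\<^sub>m\<close>
(\<open>order_chain_cells\<close>). For \<open>r\<close> iid observations this has probability
\<open>r (r - 1) \<cdots> (r - m + 1) \<Prod> (F V\<^sub>i - F U\<^sub>i) (1 - F U\<^sub>m)^(r - m)\<close>, where \<open>U\<^sub>i, V\<^sub>i\<close> are the levels before norming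
(\<open>prob_one_sample_point_per_cell\<close>), and for the Poisson points \<open>\<Prod> (g\<^sub>\<gamma> v\<^sub>i - g\<^sub>\<gamma> u\<^sub>i) exp (- g\<^sub>\<gamma> u\<^sub>m)\<close>
(\<open>poisson_prob_order_box\<close>). The domain of attraction condition gives \<open>r F \<longlonglongrightarrow> g\<^sub>\<gamma>\<close> and
\<open>(1 - F)^r \<longlonglongrightarrow> exp (- g\<^sub>\<gamma>)\<close> along the normed levels, whence the first probability tends to the second. That
the sample grows with \<open>j\<close> is harmless, because with high probability the few additional observations
are not among the smallest (\<open>prob_sample_order_box_approx\<close>).

Convergence on boxes suffices for weak convergence in \<open>\<real>\<^sup>\<infinity>\<close>: nonempty intersections of boxes are boxes, and
every strictly increasing sequence has arbitrarily small boxes as neighbourhoods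
(\<open>order_boxes_local_base\<close>), so \<open>weak_conv_borel_Int_stable_local_base\<close> applies. The limit is almost surely
strictly increasing since a Poisson process has no multiple points
(\<open>poisson_points_strictly_increasing\<close>).
\<close>

section \<open>Weak convergence from an intersection-stable class\<close>

text \<open>By inclusion-exclusion: the measure of \<open>C k \<union> \<Union>C i\<close> is determined by the measures of \<open>C k\<close>, of a union
of fewer sets, and of \<open>\<Union>(C k \<inter> C i)\<close>, which is again a union of fewer sets from the stable class.\<close>

lemma tendsto_measure_finite_Union:
  fixes \<mu> :: "nat \<Rightarrow> 'a measure"
  assumes prob: "\<forall>\<^sub>F n in sequentially. prob_space (\<mu> n)" "prob_space \<nu>"
    and sets: "\<And>n. sets (\<mu> n) = S" "sets \<nu> = S"
    and lim: "\<forall>A\<in>\<A>. A \<in> S \<and> (\<lambda>n. measure (\<mu> n) A) \<longlonglongrightarrow> measure \<nu> A"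
    and Int: "\<forall>A\<in>\<A>. \<forall>B\<in>\<A>. A \<inter> B \<in> \<A>"
    and "finite I" "\<And>i. i \<in> I \<Longrightarrow> C i \<in> \<A>"
  shows "(\<lambda>n. measure (\<mu> n) (\<Union>i\<in>I. C i)) \<longlonglongrightarrow> measure \<nu> (\<Union>i\<in>I. C i)"
  using assms(7,8)
proof (induction I arbitrary: C rule: finite_induct)
  case empty
  then show ?case by simp
next
  case (insert k I)
  have C: "C k \<in> S" "(\<Union>i\<in>I. C i) \<in> S"
    using lim insert.prems insert.hyps(1) unfolding sets(2)[symmetric] by (auto intro!: sets.finite_UN)
  have split: "measure M (\<Union>i\<in>insert k I. C i)
      = measure M (C k) + measure M (\<Union>i\<in>I. C i) - measure M (\<Union>i\<in>I. C k \<inter> C i)"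
    if "prob_space M" "sets M = S" for M
  proof -
    interpret prob_space M by fact
    have "measure M (C k \<union> (\<Union>i\<in>I. C i))
        = measure M (C k) + measure M (\<Union>i\<in>I. C i) - measure M (C k \<inter> (\<Union>i\<in>I. C i))"
      using C unfolding that(2)[symmetric] fmeasurable_eq_sets[symmetric] by (rule measure_Un3)
    then show ?thesis by (simp only: Int_UN_distrib UN_insert)
  qed
  have "(\<lambda>n. measure (\<mu> n) (C k) + measure (\<mu> n) (\<Union>i\<in>I. C i) - measure (\<mu> n) (\<Union>i\<in>I. C k \<inter> C i))
      \<longlonglongrightarrow> measure \<nu> (C k) + measure \<nu> (\<Union>i\<in>I. C i) - measure \<nu> (\<Union>i\<in>I. C k \<inter> C i)"
  proof (intro tendsto_diff tendsto_add)
    show "(\<lambda>n. measure (\<mu> n) (C k)) \<longlonglongrightarrow> measure \<nu> (C k)"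
      using bspec[OF lim insert.prems[OF insertI1]] by blast
    show "(\<lambda>n. measure (\<mu> n) (\<Union>i\<in>I. C i)) \<longlonglongrightarrow> measure \<nu> (\<Union>i\<in>I. C i)"
      by (rule insert.IH) (use insert.prems in auto)
    show "(\<lambda>n. measure (\<mu> n) (\<Union>i\<in>I. C k \<inter> C i)) \<longlonglongrightarrow> measure \<nu> (\<Union>i\<in>I. C k \<inter> C i)"
      by (rule insert.IH) (use insert.prems Int in auto)
  qed
  moreover have "\<forall>\<^sub>F n in sequentially. measure (\<mu> n) (C k) + measure (\<mu> n) (\<Union>i\<in>I. C i)
      - measure (\<mu> n) (\<Union>i\<in>I. C k \<inter> C i) = measure (\<mu> n) (\<Union>i\<in>insert k I. C i)"
    using prob(1) by eventually_elim (rule split[OF _ sets(1), symmetric])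
  ultimately show ?case
    unfolding split[OF prob(2) sets(2)] by (rule Lim_transform_eventually)
qed

text \<open>The lower bound for open sets in the portmanteau theorem. The space is second countable, so
Lindelof's theorem covers \<open>U\<close>, up to a \<open>\<nu>\<close>-null set, by countably many members of \<open>\<A>\<close> inside \<open>U\<close>;
finitely many of them carry all but \<open>\<epsilon>\<close> of \<open>\<nu> U\<close>, and on a finite union the measures converge.\<close>

lemma eventually_measure_open_gt:
  fixes \<mu> :: "nat \<Rightarrow> 'a::second_countable_topology measure"
  assumes prob: "\<forall>\<^sub>F n in sequentially. prob_space (\<mu> n)" "prob_space \<nu>"
    and sets: "\<And>n. sets (\<mu> n) = sets borel" "sets \<nu> = sets borel"
    and lim: "\<forall>A\<in>\<A>. A \<in> sets borel \<and> (\<lambda>n. measure (\<mu> n) A) \<longlonglongrightarrow> measure \<nu> A"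
    and Int: "\<forall>A\<in>\<A>. \<forall>B\<in>\<A>. A \<inter> B \<in> \<A>"
    and base: "AE z in \<nu>. \<forall>U. open U \<and> z \<in> U \<longrightarrow> (\<exists>A\<in>\<A>. z \<in> interior A \<and> A \<subseteq> U)"
    and U: "open U" and e: "(\<epsilon>::real) > 0"
  shows "\<forall>\<^sub>F n in sequentially. measure (\<mu> n) U > measure \<nu> U - \<epsilon>"
proof -
  interpret \<nu>: prob_space \<nu> by fact
  let ?B = "{A \<in> \<A>. A \<subseteq> U}"
  obtain \<F> where F: "\<F> \<subseteq> interior ` ?B" "countable \<F>" "\<Union>\<F> = \<Union>(interior ` ?B)"
    by (rule Lindelof[of "interior ` ?B"]) auto
  then obtain \<C> where C: "countable \<C>" "\<C> \<subseteq> ?B" "\<F> = interior ` \<C>"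
    using countable_subset_image[of \<F> interior ?B] by metis
  have CU: "\<Union>\<C> \<subseteq> U" and Cborel: "\<And>A. A \<in> \<C> \<Longrightarrow> A \<in> sets borel"
    using C(2) lim by auto
  have UB: "U \<in> sets \<nu>" "\<Union>\<C> \<in> sets \<nu>"
    using U sets(2) C(1) Cborel by (auto intro!: sets.countable_Union)
  have "AE z in \<nu>. z \<in> U \<longrightarrow> z \<in> \<Union>\<C>"
    using base
  proof eventually_elim
    case (elim z)
    show ?case
    proof
      assume "z \<in> U"
      then obtain A where "A \<in> \<A>" "z \<in> interior A" "A \<subseteq> U" using elim U by blast
      then have "z \<in> \<Union>\<F>" unfolding F(3) by blast
      then show "z \<in> \<Union>\<C>" using C(3) interior_subset by auto
    qed
  qed
  then have le: "measure \<nu> U \<le> measure \<nu> (\<Union>\<C>)"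
    using UB by (intro \<nu>.finite_measure_mono_AE) auto
  obtain I where I: "finite I" "I \<subseteq> \<C>" "measure \<nu> (\<Union>I) > measure \<nu> (\<Union>\<C>) - \<epsilon>"
  proof (cases "\<C> = {}")
    case True
    then show ?thesis using that[of "{}"] e by simp
  next
    case False
    define c where "c = from_nat_into \<C>"
    have cr: "range c = \<C>" unfolding c_def by (rule range_from_nat_into[OF False C(1)])
    have "(\<lambda>n. measure \<nu> (\<Union>i\<le>n. c i)) \<longlonglongrightarrow> measure \<nu> (\<Union>n. \<Union>i\<le>n. c i)"
    proof (intro \<nu>.finite_Lim_measure_incseq)
      show "range (\<lambda>n. \<Union>i\<le>n. c i) \<subseteq> sets \<nu>"
        using Cborel cr sets(2) by (auto intro!: sets.finite_UN)
      show "incseq (\<lambda>n. \<Union>i\<le>n. c i)"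
        unfolding incseq_def by (blast intro: order_trans)
    qed
    moreover have "(\<Union>n. \<Union>i\<le>n. c i) = \<Union>\<C>" unfolding cr[symmetric] by blast
    ultimately have "\<forall>\<^sub>F n in sequentially. measure \<nu> (\<Union>i\<le>n. c i) > measure \<nu> (\<Union>\<C>) - \<epsilon>"
      using e by (intro order_tendstoD(1)) auto
    then obtain n where "measure \<nu> (\<Union>i\<le>n. c i) > measure \<nu> (\<Union>\<C>) - \<epsilon>"
      by (meson eventually_happens trivial_limit_sequentially)
    then show ?thesis using that[of "c ` {..n}"] cr by auto
  qed
  have "(\<lambda>n. measure (\<mu> n) (\<Union>A\<in>I. A)) \<longlonglongrightarrow> measure \<nu> (\<Union>A\<in>I. A)"
    using I(1,2) C(2) by (intro tendsto_measure_finite_Union[OF prob sets lim Int]) auto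
  then have "\<forall>\<^sub>F n in sequentially. measure (\<mu> n) (\<Union>I) > measure \<nu> U - \<epsilon>"
    using I(3) le by (intro order_tendstoD(1)) auto
  then show ?thesis using prob(1)
  proof eventually_elim
    case (elim n)
    interpret prob_space "\<mu> n" by fact
    have "measure (\<mu> n) (\<Union>I) \<le> measure (\<mu> n) U"
      using I(2) CU U sets(1) by (intro finite_measure_mono) auto
    then show ?case using elim by simp
  qed
qed

text \<open>A value in \<open>[0, 1)\<close> is, up to \<open>1 / K\<close>, the proportion of the levels \<open>k / K\<close> that it exceeds. Integrated
over the values of a function \<open>f\<close>, this replaces \<open>\<integral>f\<close> by finitely many measures of the sets
\<open>{f > k / K}\<close>, which are open when \<open>f\<close> is continuous.\<close>

lemma staircase_approx:
  fixes t :: real assumes "0 \<le> t" "t < 1" "K > (0::nat)"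
  defines "s \<equiv> (\<Sum>k=1..K. of_bool (t > real k / real K)) / real K"
  shows "s \<le> t" "t \<le> s + 1 / real K"
proof -
  \<comment> \<open>the number of levels strictly below \<open>t\<close>\<close>
  define n where "n = nat (\<lceil>t * real K\<rceil> - 1)"
  have "0 \<le> t * real K" using assms by simp
  then have c: "\<lceil>t * real K\<rceil> \<ge> 0" by linarith
  have iff: "t > real k / real K \<longleftrightarrow> k \<le> n" if "k \<ge> 1" for k
  proof -
    have "t > real k / real K \<longleftrightarrow> real k < t * real K" using assms by (simp add: field_simps)
    also have "\<dots> \<longleftrightarrow> int k < \<lceil>t * real K\<rceil>" by (simp add: less_ceiling_iff)
    also have "\<dots> \<longleftrightarrow> k \<le> n" unfolding n_def using that by linarith
    finally show ?thesis .
  qed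
  have "\<lceil>t * real K\<rceil> \<le> int K" using assms by (simp add: ceiling_le_iff)
  then have nK: "n \<le> K" unfolding n_def by linarith
  have "(\<Sum>k=1..K. of_bool (t > real k / real K)) = (\<Sum>k=1..K. of_bool (k \<le> n))"
    using iff by (intro sum.cong) auto
  also have "\<dots> = real (card ({1..K} \<inter> {k. k \<le> n}))" by (simp add: sum_of_bool_eq)
  also have "{1..K} \<inter> {k. k \<le> n} = {1..n}" using nK by auto
  finally have s: "s = real n / real K" unfolding s_def by simp
  have "real n \<le> t * real K" "t * real K \<le> real n + 1"
    unfolding n_def using c \<open>0 \<le> t * real K\<close> by linarith+
  then show "s \<le> t" "t \<le> s + 1 / real K" unfolding s using assms(3) by (auto simp: field_simps)
qed

lemma integral_staircase_approx:
  fixes f :: "'a \<Rightarrow> real"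
  assumes "prob_space M" "f \<in> borel_measurable M" "\<And>z. 0 \<le> f z" "\<And>z. f z < 1" "K > (0::nat)"
  defines "s \<equiv> (\<Sum>k=1..K. measure M {z\<in>space M. f z > real k / real K}) / real K"
  shows "s \<le> integral\<^sup>L M f" "integral\<^sup>L M f \<le> s + 1 / real K"
proof -
  interpret prob_space M by fact
  note [measurable] = assms(2)
  define h where "h z = (\<Sum>k=1..K. indicator {z\<in>space M. f z > real k / real K} z) / real K" for z
  have int: "integrable M f"
    using assms(3,4) by (intro integrable_const_bound[where B = 1]) (auto intro: less_imp_le)
  have inth: "integrable M h" unfolding h_def by (auto intro!: integrable_real_indicator simp: emeasure_eq_measure)
  have h: "integral\<^sup>L M h = s" unfolding h_def s_def
    by (subst integral_divide_zero, subst Bochner_Integration.integral_sum)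
      (auto intro!: integrable_real_indicator simp: emeasure_eq_measure)
  have hf: "h z = (\<Sum>k=1..K. of_bool (f z > real k / real K)) / real K" if "z \<in> space M" for z
    unfolding h_def using that by (simp add: indicator_def)
  show "s \<le> integral\<^sup>L M f" unfolding h[symmetric]
    using staircase_approx(1)[OF assms(3,4,5)] hf by (intro integral_mono int inth) auto
  have "integral\<^sup>L M f \<le> (\<integral>z. h z + 1 / real K \<partial>M)"
    using staircase_approx(2)[OF assms(3,4,5)] hf by (intro integral_mono int Bochner_Integration.integrable_add inth) auto
  also have "\<dots> = s + 1 / real K" using inth h by (simp add: prob_space)
  finally show "integral\<^sup>L M f \<le> s + 1 / real K" .
qed

lemma eventually_integral_gt:
  fixes f :: "'a::topological_space \<Rightarrow> real"
  assumes prob: "\<forall>\<^sub>F n in sequentially. prob_space (\<mu> n)" "prob_space \<nu>"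
    and sets: "\<And>n. sets (\<mu> n) = sets borel" "sets \<nu> = sets borel"
    and Uopen: "\<And>U \<epsilon>. open U \<Longrightarrow> \<epsilon> > 0 \<Longrightarrow> \<forall>\<^sub>F n in sequentially. measure (\<mu> n) U > measure \<nu> U - \<epsilon>"
    and f: "continuous_on UNIV f" "\<And>z. 0 \<le> f z" "\<And>z. f z < 1" and e: "(\<epsilon>::real) > 0"
  shows "\<forall>\<^sub>F n in sequentially. integral\<^sup>L (\<mu> n) f > integral\<^sup>L \<nu> f - \<epsilon>"
proof -
  obtain K :: nat where K: "K > 0" "1 / real K < \<epsilon> / 2"
    using real_arch_invD[of "\<epsilon> / 2"] e by (auto simp: inverse_eq_divide)
  let ?U = "\<lambda>k. {z. f z > real k / real K}"
  have meas: "f \<in> borel_measurable M" "space M = UNIV" if "sets M = sets borel" for M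
    using borel_measurable_continuous_onI[OF f(1)] that measurable_cong_sets[OF that refl]
      sets_eq_imp_space_eq[OF that] by auto
  have "open (?U k)" for k
    using f(1) by (intro open_Collect_less continuous_on_const) auto
  then have "\<forall>\<^sub>F n in sequentially. \<forall>k\<in>{1..K}. measure (\<mu> n) (?U k) > measure \<nu> (?U k) - \<epsilon> / 2"
    using e by (intro eventually_ball_finite ballI Uopen) auto
  with prob(1) show ?thesis
  proof eventually_elim
    case (elim n)
    have "integral\<^sup>L \<nu> f \<le> (\<Sum>k=1..K. measure \<nu> (?U k)) / real K + 1 / real K"
      using integral_staircase_approx(2)[OF prob(2) meas(1)[OF sets(2)] f(2,3) K(1)] meas(2)[OF sets(2)]
      by simp
    also have "(\<Sum>k=1..K. measure \<nu> (?U k)) \<le> (\<Sum>k=1..K. measure (\<mu> n) (?U k) + \<epsilon> / 2)"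
      using elim(2) by (intro sum_mono) (auto simp: less_imp_le algebra_simps)
    also have "\<dots> / real K = (\<Sum>k=1..K. measure (\<mu> n) (?U k)) / real K + \<epsilon> / 2"
      using K(1) unfolding sum.distrib by (simp add: field_simps)
    also have "(\<Sum>k=1..K. measure (\<mu> n) (?U k)) / real K \<le> integral\<^sup>L (\<mu> n) f"
      using integral_staircase_approx(1)[OF elim(1) meas(1)[OF sets(1)] f(2,3) K(1)] meas(2)[OF sets(1)]
      by simp
    finally show ?case using K by (simp add: divide_right_mono)
  qed
qed

text \<open>Convergence on a class that is stable under intersections and contains arbitrarily small
neighbourhoods of almost every point already implies weak convergence (Billingsley,
\<^emph>\<open>Convergence of Probability Measures\<close>, Theorem 2.3). The neighbourhoods are only required at almost
every point of the limit law, so a class adapted to the support of \<open>\<nu>\<close> suffices.\<close>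

theorem weak_conv_borel_Int_stable_local_base:
  fixes \<mu> :: "nat \<Rightarrow> 'a::second_countable_topology measure"
  assumes prob: "\<forall>\<^sub>F n in sequentially. prob_space (\<mu> n)" "prob_space \<nu>"
    and sets: "\<And>n. sets (\<mu> n) = sets borel" "sets \<nu> = sets borel"
    and lim: "\<forall>A\<in>\<A>. A \<in> sets borel \<and> (\<lambda>n. measure (\<mu> n) A) \<longlonglongrightarrow> measure \<nu> A"
    and Int: "\<forall>A\<in>\<A>. \<forall>B\<in>\<A>. A \<inter> B \<in> \<A>"
    and base: "AE z in \<nu>. \<forall>U. open U \<and> z \<in> U \<longrightarrow> (\<exists>A\<in>\<A>. z \<in> interior A \<and> A \<subseteq> U)"
  shows "weak_conv_borel \<mu> \<nu>"
  unfolding weak_conv_borel_def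
proof (intro allI impI)
  fix f :: "'a \<Rightarrow> real"
  assume f: "continuous_on UNIV f \<and> bounded (range f)"
  then obtain c where c: "c > 0" "\<And>z. \<bar>f z\<bar> \<le> c"
    unfolding bounded_pos by auto
  \<comment> \<open>an affine copy of \<open>f\<close> such that both \<open>g\<close> and \<open>1 - g\<close> take values in \<open>[0, 1)\<close>; the lower bounds
    for these two functions together give the limit\<close>
  define g where "g z = (f z / c + 2) / 4" for z
  have g: "0 \<le> g z" "g z < 1" for z
    using c(2)[of z] c(1) unfolding g_def by (auto simp: field_simps abs_le_iff)
  have fc: "continuous_on UNIV f" using f by auto
  have gc: "continuous_on UNIV g" unfolding g_def using c(1) by (intro continuous_intros fc) auto
  have g': "continuous_on UNIV (\<lambda>z. 1 - g z)" "0 \<le> 1 - g z" "1 - g z < 1" for z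
    using g[of z] c(2)[of z] c(1) unfolding g_def
    by (auto intro!: continuous_intros fc simp: field_simps abs_le_iff)
  have intg: "integrable M g" if "prob_space M" "sets M = sets borel" for M
  proof -
    interpret prob_space M by fact
    have "g \<in> borel_measurable M"
      using borel_measurable_continuous_onI[OF gc] measurable_cong_sets[OF that(2) refl] by auto
    then show ?thesis using g
      by (intro integrable_const_bound[where B = 1]) (auto intro: less_imp_le)
  qed
  have int1: "(\<integral>z. 1 - g z \<partial>M) = 1 - integral\<^sup>L M g" if "prob_space M" "sets M = sets borel" for M
  proof -
    interpret prob_space M by fact
    show ?thesis using intg[OF that] by (simp add: prob_space)
  qed
  have gt: "\<forall>\<^sub>F n in sequentially. integral\<^sup>L (\<mu> n) h > integral\<^sup>L \<nu> h - \<epsilon>"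
    if "continuous_on UNIV h" "\<And>z. 0 \<le> h z" "\<And>z. h z < 1" "\<epsilon> > 0" for h :: "'a \<Rightarrow> real" and \<epsilon>
    by (rule eventually_integral_gt[OF prob sets eventually_measure_open_gt[OF prob sets lim Int base] that])
  have glim: "(\<lambda>n. integral\<^sup>L (\<mu> n) g) \<longlonglongrightarrow> integral\<^sup>L \<nu> g"
  proof (rule tendstoI)
    fix \<epsilon> :: real assume e: "\<epsilon> > 0"
    show "\<forall>\<^sub>F n in sequentially. dist (integral\<^sup>L (\<mu> n) g) (integral\<^sup>L \<nu> g) < \<epsilon>"
      using gt[OF gc g e] gt[OF g' e] prob(1)
    proof eventually_elim
      case (elim n)
      then show ?case
        using int1[OF elim(3) sets(1)] int1[OF prob(2) sets(2)] by (simp add: dist_real_def)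
    qed
  qed
  have fg: "integral\<^sup>L M f = c * (4 * integral\<^sup>L M g - 2)" if "prob_space M" "sets M = sets borel" for M
  proof -
    interpret prob_space M by fact
    have "f = (\<lambda>z. c * (4 * g z - 2))" unfolding g_def using c(1) by (auto simp: field_simps)
    then show ?thesis using intg[OF that] by (simp add: prob_space)
  qed
  have "(\<lambda>n. c * (4 * integral\<^sup>L (\<mu> n) g - 2)) \<longlonglongrightarrow> c * (4 * integral\<^sup>L \<nu> g - 2)"
    by (intro tendsto_intros glim)
  moreover have "\<forall>\<^sub>F n in sequentially. c * (4 * integral\<^sup>L (\<mu> n) g - 2) = integral\<^sup>L (\<mu> n) f"
    using prob(1) by eventually_elim (simp add: fg sets(1))
  ultimately show "(\<lambda>n. integral\<^sup>L (\<mu> n) f) \<longlonglongrightarrow> integral\<^sup>L \<nu> f"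
    unfolding fg[OF prob(2) sets(2)] by (rule Lim_transform_eventually)
qed

section \<open>Boxes with interlaced levels\<close>

text \<open>For a nondecreasing sequence \<open>z\<close> and the interlaced levels of \<open>order_chain\<close> below, membership says that
\<open>z\<close> has exactly one entry in each of the first \<open>m\<close> cells \<open>{u i<..v i}\<close> and no other entry up to level
\<open>u m\<close>. The last level \<open>u m\<close> has no partner: it only bounds the entry \<open>z m\<close> from below, which makes it
possible to count all entries up to \<open>u m\<close>.\<close>

definition order_box :: "nat \<Rightarrow> (nat \<Rightarrow> real) \<Rightarrow> (nat \<Rightarrow> real) \<Rightarrow> (nat \<Rightarrow> real) set" where
  "order_box m u v = {z. (\<forall>i\<le>m. u i < z i) \<and> (\<forall>i<m. z i \<le> v i)}"

definition order_chain :: "nat \<Rightarrow> (nat \<Rightarrow> real) \<Rightarrow> (nat \<Rightarrow> real) \<Rightarrow> bool" where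
  "order_chain m u v \<longleftrightarrow> (\<forall>i<m. u i < v i \<and> v i \<le> u (Suc i))"

definition order_boxes :: "real set \<Rightarrow> (nat \<Rightarrow> real) set set" where
  "order_boxes S = {order_box m u v | m u v.
     order_chain m u v \<and> (\<forall>i\<le>m. u i \<in> S) \<and> (\<forall>i<m. v i \<in> S)}"

lemma order_box_borel: "order_box m u v \<in> sets borel"
proof -
  have [measurable]: "(\<lambda>z::nat \<Rightarrow> real. z i) \<in> borel_measurable borel" for i
    by (rule borel_measurable_continuous_onI) simp
  have "{z \<in> space borel. (\<forall>i\<le>m. u i < z i) \<and> (\<forall>i<m. z i \<le> v i)} \<in> sets borel"
    by measurable
  then show ?thesis by (simp add: order_box_def)
qed

text \<open>The empty set has to be excluded because the levels of an empty intersection need not interlace.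
A point of the intersection separates the new levels: \<open>max (u i) (u' i) < z i \<le> min (v i) (v' i)\<close>.\<close>

lemma order_boxes_Int:
  assumes A: "A \<in> order_boxes S" and B: "B \<in> order_boxes S" and ne: "A \<inter> B \<noteq> {}"
  shows "A \<inter> B \<in> order_boxes S"
proof -
  have *: "order_box m u v \<inter> order_box m' u' v' \<in> order_boxes S"
    if le: "m \<le> m'" and uv: "order_chain m u v" "\<forall>i\<le>m. u i \<in> S" "\<forall>i<m. v i \<in> S"
      and uv': "order_chain m' u' v'" "\<forall>i\<le>m'. u' i \<in> S" "\<forall>i<m'. v' i \<in> S"
      and z: "z \<in> order_box m u v \<inter> order_box m' u' v'"
    for m u v m' u' v' z
  proof -
    define p where "p i = (if i \<le> m then max (u i) (u' i) else u' i)" for i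
    define q where "q i = (if i < m then min (v i) (v' i) else v' i)" for i
    have "order_box m u v \<inter> order_box m' u' v' = order_box m' p q"
      using le unfolding order_box_def p_def q_def by (auto split: if_splits)
    moreover have "order_chain m' p q"
      unfolding order_chain_def
    proof (intro allI impI conjI)
      fix i assume i: "i < m'"
      have "p i < z i" "z i \<le> q i" using z i le unfolding order_box_def p_def q_def by auto
      then show "p i < q i" by simp
      show "q i \<le> p (Suc i)"
        using uv(1) uv'(1) i le unfolding order_chain_def p_def q_def
        by (auto simp: min_le_iff_disj le_max_iff_disj)
    qed
    moreover have "\<forall>i\<le>m'. p i \<in> S" "\<forall>i<m'. q i \<in> S"
      using uv uv' le unfolding p_def q_def by (auto simp: max_def min_def)
    ultimately show ?thesis unfolding order_boxes_def by blast
  qed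
  obtain z where z: "z \<in> A" "z \<in> B" using ne by blast
  obtain m u v where a: "A = order_box m u v" "order_chain m u v" "\<forall>i\<le>m. u i \<in> S" "\<forall>i<m. v i \<in> S"
    using A unfolding order_boxes_def by blast
  obtain m' u' v' where b: "B = order_box m' u' v'" "order_chain m' u' v'" "\<forall>i\<le>m'. u' i \<in> S" "\<forall>i<m'. v' i \<in> S"
    using B unfolding order_boxes_def by blast
  show ?thesis
  proof (cases "m \<le> m'")
    case True
    show ?thesis unfolding a(1) b(1) by (rule *[of _ _ _ _ _ _ z]) (use True a b z in auto)
  next
    case False
    have "B \<inter> A \<in> order_boxes S"
      unfolding a(1) b(1) by (rule *[of _ _ _ _ _ _ z]) (use False a b z in auto)
    then show ?thesis by (simp add: Int_commute)
  qed
qed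

text \<open>A neighbourhood of \<open>z\<close> restricts only finitely many coordinates. As \<open>z\<close> is strictly increasing, its
first coordinates have disjoint small cells around them; radii of at most half the adjacent gaps
make the cells interlace.\<close>

lemma order_boxes_local_base:
  assumes S: "open S" "convex S" and zS: "\<And>i. z i \<in> S" and z: "strict_mono z"
    and U: "open U" "z \<in> U"
  shows "\<exists>A\<in>order_boxes S. z \<in> interior A \<and> A \<subseteq> U"
proof -
  have "openin (product_topology (\<lambda>i. euclidean) UNIV) U" using U(1) by (simp add: open_fun_def)
  from product_topology_open_contains_basis[OF this U(2)]
  obtain V where V: "z \<in> Pi\<^sub>E UNIV V" "\<And>i. open (V i)" "finite {i. V i \<noteq> UNIV}" "Pi\<^sub>E UNIV V \<subseteq> U"
    by auto
  obtain m where m: "\<And>i. V i \<noteq> UNIV \<Longrightarrow> i < m"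
    using finite_nat_set_iff_bounded V(3) by auto
  have lt: "z i < z (Suc i)" for i using z by (simp add: strict_mono_Suc_iff)
  \<comment> \<open>nothing lies below \<open>z 0\<close>, so its lower gap may be any positive number\<close>
  define gap where "gap i = (case i of 0 \<Rightarrow> 1 | Suc j \<Rightarrow> z i - z j)" for i
  have gap: "gap i > 0" for i using lt by (auto simp: gap_def split: nat.split)
  have "\<exists>e>0. cball (z i) e \<subseteq> V i \<inter> S \<and> e \<le> gap i / 2 \<and> e \<le> gap (Suc i) / 2" for i
  proof -
    have "open (V i \<inter> S)" "z i \<in> V i \<inter> S" using V(1,2) S zS by (auto simp: PiE_iff)
    then obtain d where d: "d > 0" "cball (z i) d \<subseteq> V i \<inter> S" by (meson open_contains_cball)
    show ?thesis
      by (rule exI[of _ "min d (min (gap i / 2) (gap (Suc i) / 2))"])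
        (use d gap in \<open>auto intro: order_trans[OF _ d(2)]\<close>)
  qed
  then obtain e where e: "\<And>i. e i > 0" "\<And>i. cball (z i) (e i) \<subseteq> V i \<inter> S"
    "\<And>i. e i \<le> gap i / 2" "\<And>i. e i \<le> gap (Suc i) / 2" by metis
  define u where "u i = z i - e i" for i
  define v where "v i = z i + e i" for i
  have uv: "u i < z i" "z i < v i" "v i \<le> u (Suc i)" for i
    using e(1)[of i] e(1)[of "Suc i"] e(4)[of i] e(3)[of "Suc i"]
    unfolding u_def v_def gap_def by auto
  have in_cball: "u i \<in> cball (z i) (e i)" "v i \<in> cball (z i) (e i)" for i
    using e(1)[of i] unfolding u_def v_def by (auto simp: dist_real_def)
  then have "u i \<in> S" "v i \<in> S" for i using e(2) by blast+
  moreover have "order_chain m u v" unfolding order_chain_def using uv by (meson order.strict_trans)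
  ultimately have "order_box m u v \<in> order_boxes S" unfolding order_boxes_def by blast
  moreover have "z \<in> interior (order_box m u v)"
  proof (rule interiorI)
    have "open (Pi\<^sub>E UNIV (\<lambda>i. if i \<le> m then {u i<..<v i} else UNIV))"
      by (intro open_PiE) (auto intro: finite_subset[of _ "{..m}"])
    then show "open {z'. \<forall>i\<le>m. u i < z' i \<and> z' i < v i}"
      by (rule back_subst[where P = "open"]) (auto simp: PiE_iff split: if_splits)
  qed (use uv in \<open>auto simp: order_box_def less_imp_le\<close>)
  moreover have "order_box m u v \<subseteq> U"
  proof
    fix y assume y: "y \<in> order_box m u v"
    have "y i \<in> V i" for i
    proof (cases "i < m")
      case True
      then have "z i - e i < y i" "y i \<le> z i + e i"
        using y unfolding order_box_def u_def v_def by auto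
      then have "y i \<in> cball (z i) (e i)" by (auto simp: dist_real_def abs_le_iff)
      then show ?thesis using e(2) by blast
    next
      case False
      then show ?thesis using m by blast
    qed
    then show "y \<in> U" using V(4) by (auto simp: PiE_iff)
  qed
  ultimately show ?thesis by blast
qed

lemma order_chain_mono:
  assumes "order_chain m u v" "i \<le> j" "j \<le> m"
  shows "u i \<le> u j"
  using assms(2,3)
proof (induction j rule: dec_induct)
  case (step k)
  then show ?case using assms(1) unfolding order_chain_def by (smt (verit) Suc_le_lessD le_SucI less_imp_le order_trans Suc_leD)
qed simp

lemma order_chain_le_last:
  assumes "order_chain m u v" "i < m"
  shows "v i \<le> u m"
  using assms order_chain_mono[OF assms(1), of "Suc i" m] unfolding order_chain_def
  by (meson Suc_leI order_refl order_trans)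

lemma order_chain_disjoint:
  assumes "order_chain m u v" "i < j" "j < m"
  shows "v i \<le> u j" "{u i<..v i} \<inter> {u j<..v j} = {}"
proof -
  have "v i \<le> u (Suc i)" using assms unfolding order_chain_def by auto
  also have "\<dots> \<le> u j" using order_chain_mono[OF assms(1), of "Suc i" j] assms by simp
  finally show "v i \<le> u j" .
  then show "{u i<..v i} \<inter> {u j<..v j} = {}" by auto
qed

lemma order_chain_cell_unique:
  assumes "order_chain m u v" "i < m" "j < m" "x \<in> {u i<..v i}" "x \<in> {u j<..v j}"
  shows "i = j"
  using order_chain_disjoint(2)[OF assms(1), of i j] order_chain_disjoint(2)[OF assms(1), of j i] assms(2-)
  by (cases i j rule: linorder_cases) auto

text \<open>If \<open>c t\<close> counts the points up to \<open>t\<close>, the left-hand side says that the \<open>i\<close>-th smallest point (counted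
from 0) lies in the \<open>i\<close>-th cell, for \<open>i < m\<close>, and that the \<open>m\<close>-th lies above \<open>u m\<close>. The right-hand side
speaks only of the numbers of points in disjoint sets, and these have a tractable joint law both for
an iid sample and for a Poisson process. From left to right, \<open>i < c (v i) \<le> c (u (i + 1)) \<le> i + 1\<close>
leaves no freedom: \<open>c (u i) = i\<close> and \<open>c (v i) = i + 1\<close>.\<close>

lemma order_chain_cells:
  fixes y :: "'k \<Rightarrow> real"
  assumes ch: "order_chain m u v" and fin: "finite {k\<in>K. y k \<le> u m}"
  defines "c t \<equiv> card {k\<in>K. y k \<le> t}"
  shows "(\<forall>i\<le>m. c (u i) \<le> i) \<and> (\<forall>i<m. i < c (v i)) \<longleftrightarrow>
    (\<forall>i<m. card {k\<in>K. y k \<in> {u i<..v i}} = 1) \<and>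
    {k\<in>K. y k \<le> u m \<and> (\<forall>i<m. y k \<notin> {u i<..v i})} = {}" (is "?L \<longleftrightarrow> ?R")
proof
  have le: "u i \<le> u m" if "i \<le> m" for i using order_chain_mono[OF ch that] by simp
  note vle = order_chain_le_last[OF ch]
  have fint: "finite {k\<in>K. y k \<le> t}" if "t \<le> u m" for t
    using that by (intro finite_subset[OF _ fin]) auto
  have diff: "card {k\<in>K. y k \<in> {s<..t}} = c t - c s" if "s \<le> t" "t \<le> u m" for s t
  proof -
    have "{k\<in>K. y k \<in> {s<..t}} = {k\<in>K. y k \<le> t} - {k\<in>K. y k \<le> s}" using that by auto
    moreover have "finite {k\<in>K. y k \<le> s}" using fint[of s] that by auto
    moreover have "{k\<in>K. y k \<le> s} \<subseteq> {k\<in>K. y k \<le> t}" using that by auto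
    ultimately show ?thesis unfolding c_def by (simp only: card_Diff_subset)
  qed
  have mono: "c s \<le> c t" if "s \<le> t" "t \<le> u m" for s t
    unfolding c_def using that by (intro card_mono fint[OF that(2)]) auto
  {
    assume L: ?L
    have cu: "c (u i) = i" if "i \<le> m" for i
    proof (cases i)
      case (Suc j)
      then have "j < c (v j)" "v j \<le> u (Suc j)" using L that ch unfolding order_chain_def by auto
      then show ?thesis using L mono[of "v j" "u (Suc j)"] le[of "Suc j"] Suc that by fastforce
    qed (use L in auto)
    have cv: "c (v i) = Suc i" if "i < m" for i
      using L mono[of "v i" "u (Suc i)"] le[of "Suc i"] that cu[of "Suc i"] ch
      unfolding order_chain_def by fastforce
    have "card {k\<in>K. y k \<in> {u i<..v i}} = 1" if "i < m" for i
      using diff[of "u i" "v i"] vle[OF that] cu[of i] cv[OF that] that ch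
      unfolding order_chain_def by (simp add: less_imp_le)
    moreover have "\<exists>i<m. y k \<in> {u i<..v i}" if k: "k \<in> K" "y k \<le> u m" for k
    proof -
      \<comment> \<open>the first level above the point singles out the cell that contains it\<close>
      define i where "i = (LEAST i. y k \<le> u i)"
      have i: "y k \<le> u i" unfolding i_def by (rule LeastI, rule k)
      have im: "i \<le> m" unfolding i_def by (rule Least_le, rule k)
      have "k \<in> {k\<in>K. y k \<le> u i}" using i k by simp
      then have "c (u i) \<noteq> 0" unfolding c_def using fint[OF le[OF im]] by (auto simp: card_eq_0_iff)
      then obtain j where j: "i = Suc j" using cu[OF im] by (cases i) auto
      then have uj: "u j < y k" using not_less_Least[of j "\<lambda>i. y k \<le> u i"] unfolding i_def by auto
      have "card {k\<in>K. y k \<in> {v j<..u i}} = 0"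
        using diff[of "v j" "u i"] le[OF im] cu[OF im] cv[of j] im j ch unfolding order_chain_def by simp
      moreover have "finite {k\<in>K. y k \<in> {v j<..u i}}"
        by (rule finite_subset[OF _ fint[OF le[OF im]]]) auto
      ultimately have "{k\<in>K. y k \<in> {v j<..u i}} = {}" by simp
      then have "y k \<le> v j" using i k by fastforce
      then show ?thesis using uj j im by (intro exI[of _ j]) auto
    qed
    ultimately show ?R by blast
  }
  assume R: ?R
  have "\<forall>i. \<exists>q. i < m \<longrightarrow> {k\<in>K. y k \<in> {u i<..v i}} = {q}"
    using conjunct1[OF R] card_1_singletonE by blast
  then obtain p where p: "\<And>i. i < m \<Longrightarrow> {k\<in>K. y k \<in> {u i<..v i}} = {p i}"
    by metis
  then have pK: "p i \<in> K" "u i < y (p i)" "y (p i) \<le> v i" if "i < m" for i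
    using p[OF that] by auto
  have "c (u i) \<le> i" if "i \<le> m" for i
  proof -
    have "{k\<in>K. y k \<le> u i} \<subseteq> p ` {..<i}"
    proof clarsimp
      fix k assume k: "k \<in> K" "y k \<le> u i"
      then have "y k \<le> u m" using le[OF that] by linarith
      then obtain j where j: "j < m" "y k \<in> {u j<..v j}" using conjunct2[OF R] k(1) by blast
      have "u j < u i" using j(2) k(2) by simp
      then have "j < i" using order_chain_mono[OF ch, of i j] j by (meson not_le less_imp_le)
      then show "k \<in> p ` {..<i}" using p[OF j(1)] k j by blast
    qed
    then have "c (u i) \<le> card (p ` {..<i})" unfolding c_def by (intro card_mono) auto
    also have "\<dots> \<le> card {..<i}" by (intro card_image_le) auto
    finally show ?thesis by simp
  qed
  moreover have "i < c (v i)" if "i < m" for i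
  proof -
    have lt: "y (p j) < y (p j')" if "j < j'" "j' < m" for j j'
      using pK(3)[of j] pK(2)[of j'] order_chain_disjoint(1)[OF ch that] that by linarith
    have "inj_on p {..i}"
    proof (rule linorder_inj_onI)
      fix a b assume "a < b" "b \<in> {..i}"
      then show "p a \<noteq> p b" using lt[of a b] that by auto
    qed auto
    moreover have "p ` {..i} \<subseteq> {k\<in>K. y k \<le> v i}"
    proof clarsimp
      fix j assume "j \<le> i"
      then show "p j \<in> K \<and> y (p j) \<le> v i" using pK that lt[of j i] by (cases "j = i") fastforce+
    qed
    ultimately have "card {..i} \<le> c (v i)"
      unfolding c_def by (intro card_inj_on_le fint vle that)
    then show ?thesis by simp
  qed
  ultimately show ?L by blast
qed

section \<open>The inverse of the extreme value function\<close>

lemma evd_g_strict_mono: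
  assumes "x \<in> evd_supp \<gamma>" "y \<in> evd_supp \<gamma>" "x < y"
  shows "evd_g \<gamma> x < evd_g \<gamma> y"
proof -
  consider "\<gamma> = 0" | "\<gamma> > 0" | "\<gamma> < 0" by linarith
  then show ?thesis
  proof cases
    case 1
    then show ?thesis using assms by (simp add: evd_g_zero)
  next
    case 2
    then have "1 - \<gamma> * y < 1 - \<gamma> * x" "1 - \<gamma> * y > 0" using assms by (auto simp: evd_supp_def)
    then show ?thesis using 2 by (simp add: evd_g_nonzero powr_less_mono2_neg)
  next
    case 3
    then have "1 - \<gamma> * x < 1 - \<gamma> * y" "1 - \<gamma> * x > 0" using assms by (auto simp: evd_supp_def)
    then show ?thesis using 3 by (simp add: evd_g_nonzero powr_less_mono2)
  qed
qed

lemma evd_g_pos: "x \<in> evd_supp \<gamma> \<Longrightarrow> evd_g \<gamma> x > 0"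
  using bij_betw_evd_g[of \<gamma>] by (auto simp: bij_betw_def)

lemma evd_g_inv:
  assumes "y > 0"
  shows "evd_g_inv \<gamma> y \<in> evd_supp \<gamma>" "evd_g \<gamma> (evd_g_inv \<gamma> y) = y"
  using assms bij_betw_evd_g[of \<gamma>] unfolding evd_g_inv_def bij_betw_def
  by (auto intro!: inv_into_into f_inv_into_f)

lemma evd_g_inv_le_iff:
  assumes "y > 0" "x \<in> evd_supp \<gamma>"
  shows "evd_g_inv \<gamma> y \<le> x \<longleftrightarrow> y \<le> evd_g \<gamma> x"
  using evd_g_strict_mono[of x \<gamma> "evd_g_inv \<gamma> y"] evd_g_strict_mono[of "evd_g_inv \<gamma> y" \<gamma> x]
    evd_g_inv[OF assms(1), of \<gamma>] assms(2)
  by (metis linorder_cases linorder_not_less order.strict_iff_not nless_le)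

lemma evd_g_inv_strict_mono:
  assumes "0 < y" "y < y'"
  shows "evd_g_inv \<gamma> y < evd_g_inv \<gamma> y'"
  using evd_g_inv_le_iff[of y' "evd_g_inv \<gamma> y" \<gamma>] evd_g_inv[of y \<gamma>] assms by auto

lemma open_evd_supp: "open (evd_supp \<gamma>)"
  unfolding evd_supp_def by (intro open_Collect_less continuous_intros)

lemma convex_evd_supp: "convex (evd_supp \<gamma>)"
proof -
  have "evd_supp \<gamma> = {x. inner \<gamma> x < 1}" by (auto simp: evd_supp_def)
  then show ?thesis by (simp only: convex_halfspace_lt)
qed

text \<open>Outside \<open>(0, \<infinity>)\<close> the inverse is a choice from the empty set, which is the same value \<open>c\<close> for all
arguments; on \<open>(0, \<infinity>)\<close> it is increasing.\<close>

lemma evd_g_inv_measurable [measurable]: "evd_g_inv \<gamma> \<in> borel_measurable borel"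
proof -
  define c where "c = (SOME x::real. False)"
  have nonpos: "evd_g_inv \<gamma> y = c" if "\<not> y > 0" for y
  proof -
    have "\<not> (x \<in> evd_supp \<gamma> \<and> evd_g \<gamma> x = y)" for x using that evd_g_pos[of x \<gamma>] by auto
    then have "(\<lambda>x. x \<in> evd_supp \<gamma> \<and> evd_g \<gamma> x = y) = (\<lambda>x. False)" by blast
    then show ?thesis unfolding evd_g_inv_def inv_into_def c_def by (rule arg_cong)
  qed
  have "{y \<in> space borel. evd_g_inv \<gamma> y \<le> t} \<in> sets borel" for t
  proof -
    have "mono_on {0<..} (evd_g_inv \<gamma>)"
      by (intro mono_onI) (use evd_g_inv_strict_mono in \<open>force simp: le_less\<close>)
    then have "evd_g_inv \<gamma> \<in> borel_measurable (restrict_space borel {0<..})"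
      by (intro borel_measurable_mono_on_fnc)
    then have "{y \<in> {0<..}. evd_g_inv \<gamma> y \<le> t} \<in> sets borel"
      by (simp add: borel_measurable_iff_le space_restrict_space sets_restrict_space_iff)
    moreover have "{y \<in> space borel. evd_g_inv \<gamma> y \<le> t}
        = {y \<in> {0<..}. evd_g_inv \<gamma> y \<le> t} \<union> (if c \<le> t then {..0} else {})"
    proof (rule set_eqI)
      fix y
      show "y \<in> {y \<in> space borel. evd_g_inv \<gamma> y \<le> t} \<longleftrightarrow>
          y \<in> {y \<in> {0<..}. evd_g_inv \<gamma> y \<le> t} \<union> (if c \<le> t then {..0} else {})"
        using nonpos[of y] by (cases "y > 0") auto
    qed
    ultimately show ?thesis by auto
  qed
  then show ?thesis by (simp add: borel_measurable_iff_le)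
qed

section \<open>Order statistics of an iid sample\<close>

lemma sorted_nth_le_iff:
  fixes xs :: "'a::linorder list"
  assumes "sorted xs" "i < length xs"
  shows "xs ! i \<le> t \<longleftrightarrow> i < length (filter (\<lambda>x. x \<le> t) xs)"
  using assms
proof (induction xs arbitrary: i)
  case (Cons x xs)
  show ?case
  proof (cases "x \<le> t")
    case True
    then show ?thesis using Cons by (cases i) auto
  next
    case False
    then have "\<forall>y\<in>set (x # xs). \<not> y \<le> t" using Cons.prems(1) by auto
    moreover have "(x # xs) ! i \<in> set (x # xs)" using Cons.prems(2) by (rule nth_mem)
    ultimately have "\<not> (x # xs) ! i \<le> t" "filter (\<lambda>y. y \<le> t) (x # xs) = []"
      by (auto simp only: filter_empty_conv)
    then show ?thesis by simp
  qed
qed simp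

text \<open>Among \<open>r + j\<close> values the \<open>r\<close>-th largest is the one with index \<open>j\<close> in increasing order (counted from 0).
This turns \<open>M\<^sub>n\<^sup>(\<^sup>r\<^sup>)\<close> with \<open>n = r + j\<close> into a low order statistic, of a rank that does not depend on \<open>r\<close>.\<close>

lemma rth_largest_le_iff:
  assumes r: "r \<ge> 1"
  shows "rth_largest X r (r + j) \<omega> \<le> t \<longleftrightarrow> j < card {k \<in> {1..r + j}. X k \<omega> \<le> t}"
proof -
  let ?xs = "map (\<lambda>i. X i \<omega>) [1..<Suc (r + j)]"
  have "rth_largest X r (r + j) \<omega> = sort ?xs ! j"
    unfolding rth_largest_def using r by (subst rev_nth) auto
  also have "\<dots> \<le> t \<longleftrightarrow> j < length (filter (\<lambda>x. x \<le> t) (sort ?xs))"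
    using r by (intro sorted_nth_le_iff) auto
  also have "length (filter (\<lambda>x. x \<le> t) (sort ?xs)) = length (filter (\<lambda>x. x \<le> t) ?xs)"
    unfolding filter_sort by (rule length_sort)
  also have "\<dots> = length (filter (\<lambda>k. X k \<omega> \<le> t) [1..<Suc (r + j)])"
    by (simp only: filter_map o_def length_map)
  also have "\<dots> = card (set (filter (\<lambda>k. X k \<omega> \<le> t) [1..<Suc (r + j)]))"
    by (rule distinct_card[symmetric]) simp
  also have "set (filter (\<lambda>k. X k \<omega> \<le> t) [1..<Suc (r + j)]) = {k \<in> {1..r + j}. X k \<omega> \<le> t}"
    by auto
  finally show ?thesis .
qed

text \<open>At least \<open>j + 1\<close> of finitely many values are at most \<open>t\<close> iff all values on one of finitely many index
sets of more than \<open>j\<close> elements are.\<close>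

lemma rth_largest_measurable:
  assumes X: "\<And>k. k \<ge> 1 \<Longrightarrow> X k \<in> borel_measurable M" and r: "r \<ge> 1"
  shows "rth_largest X r (r + j) \<in> borel_measurable M"
  unfolding borel_measurable_iff_le
proof
  fix t
  have eq: "rth_largest X r (r + j) \<omega> \<le> t \<longleftrightarrow>
      (\<exists>J\<in>{J. J \<subseteq> {1..r + j} \<and> j < card J}. \<forall>k\<in>J. X k \<omega> \<le> t)" for \<omega>
    unfolding rth_largest_le_iff[OF r]
  proof
    assume "j < card {k \<in> {1..r + j}. X k \<omega> \<le> t}"
    then show "\<exists>J\<in>{J. J \<subseteq> {1..r + j} \<and> j < card J}. \<forall>k\<in>J. X k \<omega> \<le> t"
      by (intro bexI[of _ "{k \<in> {1..r + j}. X k \<omega> \<le> t}"]) auto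
  next
    assume "\<exists>J\<in>{J. J \<subseteq> {1..r + j} \<and> j < card J}. \<forall>k\<in>J. X k \<omega> \<le> t"
    then obtain J where J: "J \<subseteq> {1..r + j}" "j < card J" "\<forall>k\<in>J. X k \<omega> \<le> t" by blast
    then have "card J \<le> card {k \<in> {1..r + j}. X k \<omega> \<le> t}" by (intro card_mono) auto
    then show "j < card {k \<in> {1..r + j}. X k \<omega> \<le> t}" using J(2) by simp
  qed
  have "{\<omega> \<in> space M. \<forall>k\<in>J. X k \<omega> \<le> t} \<in> sets M" if J: "J \<subseteq> {1..r + j}" for J
  proof (intro sets.sets_Collect_finite_All)
    show "finite J" by (rule finite_subset[OF J]) simp
    fix k assume "k \<in> J"
    then have [measurable]: "X k \<in> borel_measurable M" using J by (intro X) auto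
    show "{\<omega> \<in> space M. X k \<omega> \<le> t} \<in> sets M" by measurable
  qed
  then have "{\<omega> \<in> space M. \<exists>J\<in>{J. J \<subseteq> {1..r + j} \<and> j < card J}. \<forall>k\<in>J. X k \<omega> \<le> t} \<in> sets M"
    by (intro sets.sets_Collect_finite_Ex) (auto intro: finite_subset[of _ "Pow {1..r + j}"])
  then show "{\<omega> \<in> space M. rth_largest X r (r + j) \<omega> \<le> t} \<in> sets M" unfolding eq .
qed

lemma (in prob_space) prob_half_open_interval:
  assumes "random_variable borel X" "cdf (distr M borel X) = F" "a \<le> b"
  shows "prob (X -` {a<..b} \<inter> space M) = F b - F a"
proof -
  interpret D: real_distribution "distr M borel X"
    using assms(1) by (rule real_distribution_distr)
  have "F b - F a = measure (distr M borel X) {a<..b}"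
    using D.cdf_diff_eq[of a b] assms(2,3) by (cases "a = b") auto
  then show ?thesis using assms(1) by (simp add: measure_distr)
qed

lemma (in prob_space) prob_upper_ray:
  assumes "random_variable borel X" "cdf (distr M borel X) = F"
  shows "prob (X -` {a<..} \<inter> space M) = 1 - F a"
proof -
  interpret D: real_distribution "distr M borel X"
    using assms(1) by (rule real_distribution_distr)
  have "F a = measure (distr M borel X) {..a}" by (simp add: cdf_def assms(2)[symmetric])
  moreover have "measure (distr M borel X) (space (distr M borel X) - {..a}) = 1 - measure (distr M borel X) {..a}"
    by (intro D.prob_compl) simp
  moreover have "space (distr M borel X) - {..a} = {a<..}" by auto
  ultimately have "measure (distr M borel X) {a<..} = 1 - F a" by simp
  then show ?thesis using assms(1) by (simp add: measure_distr)
qed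

text \<open>The event splits according to which sample index hits which cell. This is an injection
\<open>\<sigma> : {..<m} \<rightarrow> {1..r}\<close>; for a given \<open>\<sigma>\<close> independence yields a product, the same for each \<open>\<sigma>\<close>, and there
are \<open>r (r - 1) \<cdots> (r - m + 1)\<close> injections.\<close>

lemma (in prob_space) prob_one_sample_point_per_cell:
  assumes indep: "indep_vars (\<lambda>_. borel) X {1..}"
    and cdf: "\<And>i. i \<ge> 1 \<Longrightarrow> cdf (distr M borel (X i)) = F"
    and ch: "order_chain m u v" and mr: "m \<le> r" "r \<ge> 1"
  shows "prob {\<omega>\<in>space M. (\<forall>i<m. card {k\<in>{1..r}. X k \<omega> \<in> {u i<..v i}} = 1) \<and>
      {k\<in>{1..r}. X k \<omega> \<le> u m \<and> (\<forall>i<m. X k \<omega> \<notin> {u i<..v i})} = {}}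
    = (\<Prod>i<m. real r - real i) * ((\<Prod>i<m. F (v i) - F (u i)) * (1 - F (u m)) ^ (r - m))"
    (is "prob ?E = _")
proof -
  have rv: "random_variable borel (X k)" if "k \<ge> 1" for k
    using indep that by (auto simp: indep_vars_def)
  note vu = order_chain_le_last[OF ch]
  define \<Sigma> where "\<Sigma> = {\<sigma> \<in> {..<m} \<rightarrow>\<^sub>E {1..r}. inj_on \<sigma> {..<m}}"
  \<comment> \<open>the set prescribed for \<open>X k\<close> by \<open>\<sigma>\<close>: the cell that \<open>k\<close> is assigned to, or the ray above all cells\<close>
  define C where "C \<sigma> k = {x::real. (\<forall>j<m. \<sigma> j = k \<longrightarrow> u j < x \<and> x \<le> v j) \<and> (k \<notin> \<sigma> ` {..<m} \<longrightarrow> u m < x)}"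
    for \<sigma> :: "nat \<Rightarrow> nat" and k
  have fin: "finite \<Sigma>" unfolding \<Sigma>_def by (rule finite_subset[OF _ finite_PiE[of "{..<m}" "\<lambda>_. {1..r}"]]) auto
  have S_in: "\<sigma> j \<in> {1..r}" if "\<sigma> \<in> \<Sigma>" "j < m" for \<sigma> j
    using that(2) PiE_mem[of \<sigma> "{..<m}" "\<lambda>_. {1..r}" j] that(1) unfolding \<Sigma>_def by blast
  have C1: "C \<sigma> (\<sigma> j) = {u j<..v j}" if "\<sigma> \<in> \<Sigma>" "j < m" for \<sigma> j
  proof -
    have "\<sigma> i = \<sigma> j \<longleftrightarrow> i = j" if "i < m" for i
      using \<open>\<sigma> \<in> \<Sigma>\<close> \<open>j < m\<close> that unfolding \<Sigma>_def by (auto dest: inj_onD)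
    then show ?thesis using \<open>j < m\<close> unfolding C_def by auto
  qed
  have C2: "C \<sigma> k = {u m<..}" if "k \<notin> \<sigma> ` {..<m}" for \<sigma> k
    using that unfolding C_def by auto
  have Cb: "C \<sigma> k \<in> sets borel" if "\<sigma> \<in> \<Sigma>" for \<sigma> k
    using C1[OF that] C2[of k \<sigma>] by (cases "k \<in> \<sigma> ` {..<m}") auto
  define E where "E \<sigma> = (\<Inter>k\<in>{1..r}. X k -` C \<sigma> k \<inter> space M)" for \<sigma>
  have Ei: "\<omega> \<in> E \<sigma> \<longleftrightarrow> \<omega> \<in> space M \<and> (\<forall>k\<in>{1..r}. X k \<omega> \<in> C \<sigma> k)" for \<omega> \<sigma>
    unfolding E_def using mr by auto
  have ED: "X k \<omega> \<in> C \<sigma> k" if "\<omega> \<in> E \<sigma>" "k \<in> {1..r}" for \<omega> \<sigma> k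
    using that unfolding Ei by blast
  have Em: "E \<sigma> \<in> events" if "\<sigma> \<in> \<Sigma>" for \<sigma>
    unfolding E_def using mr Cb[OF that] rv
    by (intro sets.finite_INT) (auto intro!: measurable_sets)
  have E_prob: "prob (E \<sigma>) = (\<Prod>i<m. F (v i) - F (u i)) * (1 - F (u m)) ^ (r - m)" if s: "\<sigma> \<in> \<Sigma>" for \<sigma>
  proof -
    have im: "\<sigma> ` {..<m} \<subseteq> {1..r}" "inj_on \<sigma> {..<m}" using s unfolding \<Sigma>_def by auto
    have "prob (E \<sigma>) = (\<Prod>k\<in>{1..r}. prob (X k -` C \<sigma> k \<inter> space M))"
      unfolding E_def using mr Cb[OF s] by (intro indep_varsD[OF indep]) auto
    also have "\<dots> = (\<Prod>k\<in>\<sigma> ` {..<m}. prob (X k -` C \<sigma> k \<inter> space M))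
        * (\<Prod>k\<in>{1..r} - \<sigma> ` {..<m}. prob (X k -` C \<sigma> k \<inter> space M))"
      by (subst mult.commute, rule prod.subset_diff[OF im(1)]) simp
    also have "(\<Prod>k\<in>\<sigma> ` {..<m}. prob (X k -` C \<sigma> k \<inter> space M)) = (\<Prod>i<m. F (v i) - F (u i))"
    proof (subst prod.reindex[OF im(2)], intro prod.cong refl, simp only: o_def)
      fix j assume j: "j \<in> {..<m}"
      then have "\<sigma> j \<ge> 1" using im(1) by auto
      moreover have "j < m" "u j \<le> v j" using j ch unfolding order_chain_def by (auto intro: less_imp_le)
      ultimately show "prob (X (\<sigma> j) -` C \<sigma> (\<sigma> j) \<inter> space M) = F (v j) - F (u j)"
        unfolding C1[OF s \<open>j < m\<close>] by (intro prob_half_open_interval rv cdf)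
    qed
    also have "(\<Prod>k\<in>{1..r} - \<sigma> ` {..<m}. prob (X k -` C \<sigma> k \<inter> space M))
        = (\<Prod>k\<in>{1..r} - \<sigma> ` {..<m}. 1 - F (u m))"
    proof (intro prod.cong refl)
      fix k assume k: "k \<in> {1..r} - \<sigma> ` {..<m}"
      then have "k \<notin> \<sigma> ` {..<m}" by blast
      show "prob (X k -` C \<sigma> k \<inter> space M) = 1 - F (u m)"
        unfolding C2[OF \<open>k \<notin> \<sigma> ` {..<m}\<close>] using k by (intro prob_upper_ray rv cdf) auto
    qed
    also have "\<dots> = (1 - F (u m)) ^ (r - m)"
      using im by (simp add: card_Diff_subset card_image finite_subset)
    finally show ?thesis .
  qed
  have disj: "disjoint_family_on E \<Sigma>"
    unfolding disjoint_family_on_def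
  proof (intro ballI impI, rule ccontr)
    fix \<sigma> \<tau> assume st: "\<sigma> \<in> \<Sigma>" "\<tau> \<in> \<Sigma>" "\<sigma> \<noteq> \<tau>" "E \<sigma> \<inter> E \<tau> \<noteq> {}"
    then obtain \<omega> where w: "\<omega> \<in> E \<sigma>" "\<omega> \<in> E \<tau>" by blast
    have "\<sigma> j = \<tau> j" if j: "j < m" for j
    proof -
      have k: "\<sigma> j \<in> {1..r}" by (rule S_in[OF st(1) j])
      have x: "X (\<sigma> j) \<omega> \<in> {u j<..v j}" "X (\<sigma> j) \<omega> \<in> C \<tau> (\<sigma> j)"
        using ED[OF w(1) k] ED[OF w(2) k] by (simp_all only: C1[OF st(1) j])
      have "\<sigma> j \<in> \<tau> ` {..<m}"
      proof (rule ccontr)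
        assume "\<sigma> j \<notin> \<tau> ` {..<m}"
        then have "X (\<sigma> j) \<omega> \<in> {u m<..}" using x(2) C2 by blast
        then show False using x(1) vu[OF j] by simp
      qed
      then obtain i where i: "i < m" "\<sigma> j = \<tau> i" by auto
      then have "X (\<sigma> j) \<omega> \<in> {u i<..v i}" using x(2) C1[OF st(2) i(1)] by simp
      then have "i = j"
        using order_chain_cell_unique[OF ch i(1) j] x(1) by blast
      then show ?thesis using i by simp
    qed
    then have "\<sigma> = \<tau>" using st(1,2) unfolding \<Sigma>_def by (intro PiE_ext[of _ "{..<m}"]) auto
    then show False using st(3) by simp
  qed
  have "?E = (\<Union>\<sigma>\<in>\<Sigma>. E \<sigma>)"
  proof (intro subset_antisym subsetI)
    fix \<omega> assume w: "\<omega> \<in> ?E"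
    have w1: "\<omega> \<in> space M" "\<And>i. i < m \<Longrightarrow> card {k\<in>{1..r}. X k \<omega> \<in> {u i<..v i}} = 1"
      "{k\<in>{1..r}. X k \<omega> \<le> u m \<and> (\<forall>i<m. X k \<omega> \<notin> {u i<..v i})} = {}"
      using w unfolding mem_Collect_eq by simp_all
    have "\<exists>q. i < m \<longrightarrow> {k\<in>{1..r}. X k \<omega> \<in> {u i<..v i}} = {q}" for i
      using w1(2)[of i] by (metis card_1_singletonE)
    then obtain q where q: "\<And>i. i < m \<Longrightarrow> {k\<in>{1..r}. X k \<omega> \<in> {u i<..v i}} = {q i}" by metis
    define \<sigma> where "\<sigma> = restrict q {..<m}"
    have sp: "\<sigma> i \<in> {1..r}" "X (\<sigma> i) \<omega> \<in> {u i<..v i}" if "i < m" for i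
      using q[OF that] that unfolding \<sigma>_def by auto
    have "\<sigma> i \<noteq> \<sigma> j" if "i < j" "j < m" for i j
      using sp[of i] sp[of j] order_chain_disjoint(2)[OF ch that] that by force
    then have "inj_on \<sigma> {..<m}" by (intro linorder_inj_onI) auto
    then have s: "\<sigma> \<in> \<Sigma>" using sp unfolding \<Sigma>_def \<sigma>_def by (auto simp: PiE_iff)
    moreover have "\<omega> \<in> E \<sigma>"
      unfolding Ei
    proof (intro conjI ballI)
      fix k assume k: "k \<in> {1..r}"
      show "X k \<omega> \<in> C \<sigma> k"
      proof (cases "k \<in> \<sigma> ` {..<m}")
        case True
        then show ?thesis using sp C1[OF s] by auto
      next
        case False
        have "X k \<omega> \<notin> {u i<..v i}" if i: "i < m" for i
        proof
          assume "X k \<omega> \<in> {u i<..v i}"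
          then have "k \<in> {q i}" using q[OF i] k by blast
          then show False using False i unfolding \<sigma>_def by auto
        qed
        then have "\<not> X k \<omega> \<le> u m" using w1(3) k by blast
        then show ?thesis using C2[OF False] by simp
      qed
    qed (rule w1(1))
    ultimately show "\<omega> \<in> (\<Union>\<sigma>\<in>\<Sigma>. E \<sigma>)" by blast
  next
    fix \<omega> assume "\<omega> \<in> (\<Union>\<sigma>\<in>\<Sigma>. E \<sigma>)"
    then obtain \<sigma> where s: "\<sigma> \<in> \<Sigma>" and w: "\<omega> \<in> E \<sigma>" by blast
    have loc: "X k \<omega> \<in> {u i<..v i} \<longleftrightarrow> k = \<sigma> i" if k: "k \<in> {1..r}" and i: "i < m" for i k
    proof
      assume x: "X k \<omega> \<in> {u i<..v i}"
      show "k = \<sigma> i"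
      proof (cases "k \<in> \<sigma> ` {..<m}")
        case True
        then obtain j where j: "j < m" "k = \<sigma> j" by auto
        then have "X k \<omega> \<in> {u j<..v j}" using ED[OF w k] C1[OF s j(1)] by simp
        then have "i = j"
          using order_chain_cell_unique[OF ch i j(1)] x by blast
        then show ?thesis using j by simp
      next
        case False
        then have "u m < X k \<omega>" using ED[OF w k] C2[OF False] by simp
        then show ?thesis using x vu[OF i] by simp
      qed
    next
      assume "k = \<sigma> i"
      then show "X k \<omega> \<in> {u i<..v i}" using ED[OF w k] C1[OF s i] by simp
    qed
    have "{k\<in>{1..r}. X k \<omega> \<in> {u i<..v i}} = {\<sigma> i}" if i: "i < m" for i
    proof -
      have "\<sigma> i \<in> {1..r}" by (rule S_in[OF s i])
      then show ?thesis using loc i by blast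
    qed
    moreover have "\<exists>i<m. X k \<omega> \<in> {u i<..v i}" if k: "k \<in> {1..r}" "X k \<omega> \<le> u m" for k
    proof -
      have "k \<in> \<sigma> ` {..<m}"
      proof (rule ccontr)
        assume "k \<notin> \<sigma> ` {..<m}"
        then have "X k \<omega> \<in> {u m<..}" using ED[OF w k(1)] C2[of k \<sigma>] by simp
        then show False using k(2) by simp
      qed
      then show ?thesis using loc[OF k(1)] by auto
    qed
    ultimately show "\<omega> \<in> ?E" using w unfolding Ei by auto
  qed
  then have "prob ?E = (\<Sum>\<sigma>\<in>\<Sigma>. prob (E \<sigma>))"
    using finite_measure_finite_Union[OF fin _ disj] Em by auto
  also have "\<dots> = real (card \<Sigma>) * ((\<Prod>i<m. F (v i) - F (u i)) * (1 - F (u m)) ^ (r - m))"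
    using E_prob by simp
  also have "real (card \<Sigma>) = (\<Prod>i<m. real r - real i)"
    unfolding \<Sigma>_def using mr
    by (subst card_inj_on_subset_funcset) (auto simp: lessThan_atLeast0 of_nat_diff intro!: prod.cong)
  finally show ?thesis .
qed

text \<open>The coordinates of the sequence belong to samples of different sizes \<open>r, r + 1, \<dots>, r + m\<close>. Unless one
of the \<open>m\<close> additional observations is at most \<open>u m\<close>, all of them can be computed from the first \<open>r\<close>
observations alone, and then the probability is known exactly.\<close>

lemma (in prob_space) prob_sample_order_box_approx:
  assumes indep: "indep_vars (\<lambda>_. borel) X {1..}"
    and cdf: "\<And>i. i \<ge> 1 \<Longrightarrow> cdf (distr M borel (X i)) = F"
    and ch: "order_chain m u v" and mr: "m \<le> r" "r \<ge> 1"
  shows "\<bar>prob {\<omega> \<in> space M. (\<lambda>j. rth_largest X r (r + j) \<omega>) \<in> order_box m u v}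
      - (\<Prod>i<m. real r - real i) * ((\<Prod>i<m. F (v i) - F (u i)) * (1 - F (u m)) ^ (r - m))\<bar>
    \<le> real m * F (u m)" (is "\<bar>prob ?A - ?p\<bar> \<le> _")
proof -
  have rv: "random_variable borel (X k)" if "k \<ge> 1" for k
    using indep that by (auto simp: indep_vars_def)
  note vu = order_chain_le_last[OF ch]
  define c where "c n t \<omega> = card {k \<in> {1..n}. X k \<omega> \<le> t}" for n t \<omega>
  define B where "B = {\<omega> \<in> space M. (\<forall>i\<le>m. c r (u i) \<omega> \<le> i) \<and> (\<forall>i<m. i < c r (v i) \<omega>)}"
  \<comment> \<open>the exceptional event that a late observation is small\<close>
  define D where "D = (\<Union>k\<in>{r<..r + m}. X k -` {..u m} \<inter> space M)"
  have Beq: "B = {\<omega>\<in>space M. (\<forall>i<m. card {k\<in>{1..r}. X k \<omega> \<in> {u i<..v i}} = 1) \<and>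
      {k\<in>{1..r}. X k \<omega> \<le> u m \<and> (\<forall>i<m. X k \<omega> \<notin> {u i<..v i})} = {}}"
    unfolding B_def c_def by (intro Collect_cong conj_cong refl order_chain_cells[OF ch]) simp
  have pB: "prob B = ?p" unfolding Beq by (rule prob_one_sample_point_per_cell[OF indep cdf ch mr])
  have [measurable]: "(\<lambda>\<omega> j. rth_largest X r (r + j) \<omega>) \<in> borel_measurable M"
    using rth_largest_measurable[OF rv mr(2)] by (intro measurable_coordinatewise_then_product)
  have "?A = (\<lambda>\<omega> j. rth_largest X r (r + j) \<omega>) -` order_box m u v \<inter> space M" by auto
  then have A: "?A \<in> events" by (simp add: measurable_sets[OF _ order_box_borel])
  have Bm: "B \<in> events"
  proof -
    \<comment> \<open>a sample of size \<open>r\<close> is a sample of size \<open>(r - i) + i\<close>, so its count is governed by its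
      \<open>(r - i)\<close>-th largest value\<close>
    have c_eq: "i < c r t \<omega> \<longleftrightarrow> rth_largest X (r - i) (r - i + i) \<omega> \<le> t" if "i < r" for i t \<omega>
      using that by (subst rth_largest_le_iff) (auto simp: c_def)
    have ev: "{\<omega> \<in> space M. i < c r t \<omega>} \<in> events" for i t
    proof (cases "i < r")
      case True
      then have [measurable]: "rth_largest X (r - i) (r - i + i) \<in> borel_measurable M"
        by (intro rth_largest_measurable rv) auto
      show ?thesis unfolding c_eq[OF True] by measurable
    next
      case False
      have "c r t \<omega> \<le> card {1..r}" for \<omega> unfolding c_def by (intro card_mono) auto
      then have "\<not> i < c r t \<omega>" for \<omega> using False by (metis card_atLeastAtMost diff_Suc_1 le_trans not_le)
      then show ?thesis by simp
    qed
    have "B = {\<omega> \<in> space M. (\<forall>i\<in>{..m}. \<not> i < c r (u i) \<omega>) \<and> (\<forall>i\<in>{..<m}. i < c r (v i) \<omega>)}"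
      unfolding B_def by (auto simp: not_less)
    also have "\<dots> \<in> events"
      by (intro sets.sets_Collect_conj sets.sets_Collect_finite_All sets.sets_Collect_neg ev) auto
    finally show ?thesis .
  qed
  have below: "X k -` {..u m} \<inter> space M \<in> events" if "k \<in> {r<..r + m}" for k
    using that by (intro measurable_sets[OF rv]) auto
  then have Dm: "D \<in> events" unfolding D_def by (intro sets.finite_UN) auto
  have pD: "prob D \<le> real m * F (u m)"
  proof -
    have "prob D \<le> (\<Sum>k\<in>{r<..r + m}. prob (X k -` {..u m} \<inter> space M))"
      unfolding D_def using below by (intro finite_measure_subadditive_finite) auto
    also have "\<dots> = (\<Sum>k\<in>{r<..r + m}. F (u m))"
    proof (intro sum.cong refl)
      fix k assume "k \<in> {r<..r + m}"
      then have k: "k \<ge> 1" by simp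
      show "prob (X k -` {..u m} \<inter> space M) = F (u m)"
        unfolding cdf[OF k, symmetric] cdf_def using rv[OF k] by (simp add: measure_distr)
    qed
    finally show ?thesis by simp
  qed
  have AB: "\<omega> \<in> ?A \<longleftrightarrow> \<omega> \<in> B" if w: "\<omega> \<in> space M" "\<omega> \<notin> D" for \<omega>
  proof -
    have eq: "c (r + i) t \<omega> = c r t \<omega>" if "i \<le> m" "t \<le> u m" for i t
    proof -
      have big: "X k \<omega> > u m" if "k \<in> {r<..r + m}" for k
        using w that unfolding D_def by (force simp: not_le)
      have "k \<le> r" if "k \<le> r + i" "X k \<omega> \<le> t" for k
        using big[of k] that \<open>i \<le> m\<close> \<open>t \<le> u m\<close> by (cases "k \<le> r") auto
      then have "{k \<in> {1..r + i}. X k \<omega> \<le> t} = {k \<in> {1..r}. X k \<omega> \<le> t}" by auto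
      then show ?thesis unfolding c_def by simp
    qed
    have le: "rth_largest X r (r + i) \<omega> \<le> t \<longleftrightarrow> i < c r t \<omega>" if "i \<le> m" "t \<le> u m" for i t
      using rth_largest_le_iff[OF mr(2), of X i \<omega> t] unfolding eq[OF that, symmetric] unfolding c_def .
    have "u i < rth_largest X r (r + i) \<omega> \<longleftrightarrow> c r (u i) \<omega> \<le> i" if "i \<le> m" for i
      using le[OF that order_chain_mono[OF ch that order_refl]] by (metis not_le)
    moreover have "rth_largest X r (r + i) \<omega> \<le> v i \<longleftrightarrow> i < c r (v i) \<omega>" if "i < m" for i
      using le[OF _ vu[OF that]] that by simp
    ultimately show ?thesis using w(1) unfolding B_def order_box_def by simp
  qed
  have sub: "?A \<subseteq> space M" "B \<subseteq> space M" unfolding B_def by blast+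
  have "prob ?A \<le> prob (B \<union> D)"
  proof (rule finite_measure_mono[OF subsetI])
    fix \<omega> assume "\<omega> \<in> ?A"
    then show "\<omega> \<in> B \<union> D" using AB[of \<omega>] sub(1) by blast
  qed (use Bm Dm in blast)
  also have "\<dots> \<le> prob B + prob D" using Bm Dm by (intro measure_Un_le)
  finally have 1: "prob ?A \<le> prob B + prob D" .
  have "prob B \<le> prob (?A \<union> D)"
  proof (rule finite_measure_mono[OF subsetI])
    fix \<omega> assume "\<omega> \<in> B"
    then show "\<omega> \<in> ?A \<union> D" using AB[of \<omega>] sub(2) by blast
  qed (use A Dm in blast)
  also have "\<dots> \<le> prob ?A + prob D" using A Dm by (intro measure_Un_le)
  finally have 2: "prob B \<le> prob ?A + prob D" .
  show ?thesis using 1 2 pD unfolding pB by linarith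
qed

section \<open>Points of a Poisson process\<close>

lemma poisson_process_pointsD:
  assumes "poisson_process_points N c \<Gamma>"
  shows "prob_space N" "\<And>l. l \<ge> 1 \<Longrightarrow> \<Gamma> l \<in> borel_measurable N"
    "AE \<omega> in N. (\<forall>l\<ge>1. 0 \<le> \<Gamma> l \<omega> \<and> \<Gamma> l \<omega> \<le> \<Gamma> (Suc l) \<omega>) \<and> (\<forall>t. finite {l. 1 \<le> l \<and> \<Gamma> l \<omega> \<le> t})"
    "\<And>B k. B \<in> sets borel \<Longrightarrow> bounded B \<Longrightarrow> B \<subseteq> {0..} \<Longrightarrow>
      measure N {\<omega> \<in> space N. count_points \<Gamma> B \<omega> = k} =
           (c * measure lborel B) ^ k / fact k * exp (- (c * measure lborel B))"
    "\<And>n B. (\<And>i. i < n \<Longrightarrow> B i \<in> sets borel \<and> bounded (B i) \<and> B i \<subseteq> {0..}) \<Longrightarrow>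
      disjoint_family_on B {..<n::nat} \<Longrightarrow>
      prob_space.indep_vars N (\<lambda>_. count_space UNIV) (\<lambda>i. count_points \<Gamma> (B i)) {..<n}"
  using assms unfolding poisson_process_points_def by (auto intro: AE_conjI)

lemma count_points_measurable:
  assumes P: "poisson_process_points N c \<Gamma>" and B: "B \<in> sets borel" "bounded B" "B \<subseteq> {0..}"
  shows "count_points \<Gamma> B \<in> measurable N (count_space UNIV)"
proof -
  interpret prob_space N by (rule poisson_process_pointsD(1)[OF P])
  have "indep_vars (\<lambda>_. count_space UNIV) (\<lambda>i. count_points \<Gamma> B) {..<1::nat}"
    by (rule poisson_process_pointsD(5)[OF P]) (use B in \<open>auto simp: disjoint_family_on_def\<close>)
  then show ?thesis by (simp add: indep_vars_def)
qed

text \<open>The probability is \<open>1 - (1 + h) exp (- h)\<close>, and \<open>exp (- h) \<ge> 1 - h\<close>. The order \<open>h\<^sup>2\<close> is what excludes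
multiple points below.\<close>

lemma poisson_prob_two_points_le:
  assumes P: "poisson_process_points N 1 \<Gamma>" and x: "0 \<le> x" "0 \<le> h"
  shows "measure N {\<omega> \<in> space N. count_points \<Gamma> {x<..x + h} \<omega> \<ge> 2} \<le> h\<^sup>2"
proof -
  interpret prob_space N by (rule poisson_process_pointsD(1)[OF P])
  have B: "{x<..x + h} \<in> sets borel" "bounded {x<..x + h}" "{x<..x + h} \<subseteq> {0..}" using x by auto
  note [measurable] = count_points_measurable[OF P B]
  let ?p = "\<lambda>k. {\<omega> \<in> space N. count_points \<Gamma> {x<..x + h} \<omega> = k}"
  have pk: "prob (?p k) = h ^ k / fact k * exp (- h)" for k
    using poisson_process_pointsD(4)[OF P B, of k] x by simp
  have "{\<omega> \<in> space N. count_points \<Gamma> {x<..x + h} \<omega> \<ge> 2} = space N - (?p 0 \<union> ?p 1)" by auto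
  then have "prob {\<omega> \<in> space N. count_points \<Gamma> {x<..x + h} \<omega> \<ge> 2} = 1 - prob (?p 0 \<union> ?p 1)"
    by (simp only:) (rule prob_compl, measurable)
  also have "prob (?p 0 \<union> ?p 1) = prob (?p 0) + prob (?p 1)"
    by (rule finite_measure_Union) (measurable, auto)
  also have "\<dots> = (1 + h) * exp (- h)" unfolding pk by (simp add: algebra_simps)
  also have "1 - (1 + h) * exp (- h) \<le> 1 - (1 + h) * (1 - h)"
    using exp_ge_add_one_self[of "- h"] x by (intro diff_mono mult_left_mono) auto
  also have "\<dots> = h\<^sup>2" by (simp add: power2_eq_square algebra_simps)
  finally show ?thesis by simp
qed

text \<open>Two equal points in \<open>(0, T]\<close> fall into the same one of \<open>n\<close> cells of length \<open>T / n\<close>. The probability of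
a cell with two points is at most \<open>(T / n)\<^sup>2\<close>, in total at most \<open>T\<^sup>2 / n\<close> for every \<open>n\<close>.\<close>

lemma poisson_ties_null:
  assumes P: "poisson_process_points N 1 \<Gamma>" and T: "T > 0"
  shows "AE \<omega> in N. \<forall>l\<ge>1. 0 < \<Gamma> l \<omega> \<and> \<Gamma> l \<omega> \<le> T \<longrightarrow> \<Gamma> l \<omega> \<noteq> \<Gamma> (Suc l) \<omega>"
proof -
  interpret prob_space N by (rule poisson_process_pointsD(1)[OF P])
  define tie where "tie l = {\<omega> \<in> space N. 0 < \<Gamma> l \<omega> \<and> \<Gamma> l \<omega> \<le> T \<and> \<Gamma> l \<omega> = \<Gamma> (Suc l) \<omega>}" for l
  define D where "D = (\<Union>l\<in>{1..}. tie l)"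
  have tie: "tie l \<in> events" if "l \<ge> 1" for l
  proof -
    have [measurable]: "\<Gamma> l \<in> borel_measurable N" "\<Gamma> (Suc l) \<in> borel_measurable N"
      using poisson_process_pointsD(2)[OF P] that by auto
    show ?thesis unfolding tie_def by measurable
  qed
  then have D: "D \<in> events" unfolding D_def by (intro sets.countable_UN') auto
  have bound: "prob D \<le> T\<^sup>2 * (1 / real n)" if n: "n > 0" for n :: nat
  proof -
    define h where "h = T / real n"
    have h: "h > 0" using T n by (simp add: h_def)
    define I where "I i = {real i * h<..real i * h + h}" for i :: nat
    define A where "A i = {\<omega> \<in> space N. count_points \<Gamma> (I i) \<omega> \<ge> 2}" for i
    have IB: "I i \<in> sets borel" "bounded (I i)" "I i \<subseteq> {0..}" for i
    proof -
      have "0 \<le> real i * h" using h by simp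
      then show "I i \<subseteq> {0..}" unfolding I_def by (intro subsetI) (simp only: greaterThanAtMost_iff atLeast_iff, linarith)
    qed (auto simp: I_def)
    have A: "A i \<in> events" for i
    proof -
      note [measurable] = count_points_measurable[OF P IB[of i]]
      show ?thesis unfolding A_def by measurable
    qed
    have "AE \<omega> in N. \<omega> \<in> D \<longrightarrow> \<omega> \<in> (\<Union>i<n. A i)"
      using poisson_process_pointsD(3)[OF P]
    proof eventually_elim
      case (elim \<omega>)
      show ?case
      proof
        assume "\<omega> \<in> D"
        then obtain l where l: "l \<ge> 1" "\<omega> \<in> space N" "0 < \<Gamma> l \<omega>" "\<Gamma> l \<omega> \<le> T" "\<Gamma> l \<omega> = \<Gamma> (Suc l) \<omega>"
          unfolding D_def tie_def by blast
        define q where "q = \<Gamma> l \<omega> / h"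
        have q: "q > 0" "q \<le> real n" using l h n T by (auto simp: q_def h_def field_simps)
        define i where "i = nat (\<lceil>q\<rceil> - 1)"
        have i: "real i < q" "q \<le> real i + 1" "i < n" unfolding i_def using q by linarith+
        have mem: "\<Gamma> l \<omega> \<in> I i" using i(1,2) h by (auto simp: I_def q_def field_simps)
        have "finite {k. 1 \<le> k \<and> \<Gamma> k \<omega> \<in> I i}"
          by (rule finite_subset[of _ "{k. 1 \<le> k \<and> \<Gamma> k \<omega> \<le> real i * h + h}"])
            (use elim in \<open>auto simp: I_def\<close>)
        moreover have "{l, Suc l} \<subseteq> {k. 1 \<le> k \<and> \<Gamma> k \<omega> \<in> I i}" using mem l by auto
        ultimately have "card {l, Suc l} \<le> count_points \<Gamma> (I i) \<omega>"
          unfolding count_points_def by (rule card_mono)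
        then show "\<omega> \<in> (\<Union>i<n. A i)" using i(3) l(2) unfolding A_def by (intro UN_I[of i]) simp_all
      qed
    qed
    then have "prob D \<le> prob (\<Union>i<n. A i)"
      using A by (intro finite_measure_mono_AE) auto
    also have "\<dots> \<le> (\<Sum>i<n. prob (A i))"
      using A by (intro finite_measure_subadditive_finite) auto
    also have "\<dots> \<le> (\<Sum>i<n. h\<^sup>2)"
      unfolding A_def I_def using h by (intro sum_mono poisson_prob_two_points_le[OF P]) auto
    also have "\<dots> = T\<^sup>2 * (1 / real n)" using n by (simp add: h_def power2_eq_square field_simps)
    finally show ?thesis .
  qed
  have "prob D \<le> T\<^sup>2 * 0"
    by (rule LIMSEQ_le_const[OF tendsto_mult_left[OF lim_1_over_n]]) (use bound in \<open>auto intro: exI[of _ 1]\<close>)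
  then have "prob D = 0" by (simp add: order_antisym)
  then have "AE \<omega> in N. \<omega> \<notin> D" using D by (simp add: prob_eq_0)
  with AE_space show ?thesis by eventually_elim (auto simp: D_def tie_def)
qed

text \<open>The bounds on ties need positive points; a point at \<open>0\<close> is excluded because \<open>{0}\<close> has length zero.\<close>

lemma poisson_points_strictly_increasing:
  assumes P: "poisson_process_points N 1 \<Gamma>"
  shows "AE \<omega> in N. \<forall>l\<ge>1. 0 < \<Gamma> l \<omega> \<and> \<Gamma> l \<omega> < \<Gamma> (Suc l) \<omega>"
proof -
  interpret prob_space N by (rule poisson_process_pointsD(1)[OF P])
  have B: "{0::real} \<in> sets borel" "bounded {0::real}" "{0::real} \<subseteq> {0..}" by auto
  note [measurable] = count_points_measurable[OF P B]
  have "prob {\<omega> \<in> space N. count_points \<Gamma> {0} \<omega> = 0} = 1"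
    using poisson_process_pointsD(4)[OF P B, of 0] by simp
  then have z: "AE \<omega> in N. count_points \<Gamma> {0} \<omega> = 0"
    by (subst (asm) prob_Collect_eq_1) measurable
  have "AE \<omega> in N. \<forall>T::nat. \<forall>l\<ge>1. 0 < \<Gamma> l \<omega> \<and> \<Gamma> l \<omega> \<le> real (Suc T) \<longrightarrow> \<Gamma> l \<omega> \<noteq> \<Gamma> (Suc l) \<omega>"
    by (subst AE_all_countable) (intro allI poisson_ties_null[OF P], simp)
  with z poisson_process_pointsD(3)[OF P] show ?thesis
  proof eventually_elim
    case (elim \<omega>)
    have "finite {l. 1 \<le> l \<and> \<Gamma> l \<omega> \<in> {0}}"
      by (rule finite_subset[of _ "{k. 1 \<le> k \<and> \<Gamma> k \<omega> \<le> 0}"]) (use elim(2) in auto)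
    then have no0: "{l. 1 \<le> l \<and> \<Gamma> l \<omega> \<in> {0}} = {}"
      using elim(1) unfolding count_points_def by (simp only: card_0_eq)
    show ?case
    proof (intro allI impI conjI)
      fix l :: nat assume l: "l \<ge> 1"
      have le: "0 \<le> \<Gamma> l \<omega>" "\<Gamma> l \<omega> \<le> \<Gamma> (Suc l) \<omega>" using elim(2) l by auto
      have "\<Gamma> l \<omega> \<noteq> 0" using no0 l by auto
      then show pos: "0 < \<Gamma> l \<omega>" using le by simp
      obtain T :: nat where "\<Gamma> l \<omega> \<le> real T" using real_arch_simple by blast
      then have "\<Gamma> l \<omega> \<le> real (Suc T)" by simp
      then show "\<Gamma> l \<omega> < \<Gamma> (Suc l) \<omega>" using elim(3) l pos le by (simp add: order.not_eq_order_implies_strict)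
    qed
  qed
qed

text \<open>The \<open>m\<close> cells and the rest of \<open>[0, s m]\<close> carry independent Poisson numbers of points. The factors
\<open>exp (- length)\<close> multiply to \<open>exp (- s m)\<close>, as these sets partition \<open>[0, s m]\<close>.\<close>

lemma poisson_prob_one_point_per_cell:
  assumes P: "poisson_process_points N 1 \<Gamma>" and ch: "order_chain m s t" and s0: "s 0 \<ge> 0"
  defines "B i \<equiv> (if i < m then {s i<..t i} else {0..s m} - (\<Union>i<m. {s i<..t i}))"
  shows "measure N (\<Inter>i\<in>{..m}. count_points \<Gamma> (B i) -` {if i < m then 1 else 0} \<inter> space N)
    = (\<Prod>i<m. t i - s i) * exp (- s m)"
proof -
  interpret prob_space N by (rule poisson_process_pointsD(1)[OF P])
  have spos: "s i \<ge> 0" if "i \<le> m" for i using order_chain_mono[OF ch, of 0 i] s0 that by simp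
  have st: "s i < t i" "t i \<le> s m" if "i < m" for i
    using ch order_chain_le_last[OF ch that] that unfolding order_chain_def by auto
  have sub: "(\<Union>i<m. {s i<..t i}) \<subseteq> {0..s m}" 
  proof safe
    fix i x assume i: "i < m" "x \<in> {s i<..t i}"
    then show "x \<in> {0..s m}" using st[OF i(1)] spos[of i] by simp
  qed
  have Bm: "B m = {0..s m} - (\<Union>i<m. {s i<..t i})" unfolding B_def by simp
  have B: "B i \<in> sets borel" "bounded (B i)" "B i \<subseteq> {0..}" if "i \<le> m" for i
  proof -
    show "B i \<in> sets borel" unfolding B_def by auto
    have "B i \<subseteq> {0..s m}" using sub unfolding B_def by auto
    then show "bounded (B i)" "B i \<subseteq> {0..}" by (auto intro: bounded_subset[OF bounded_closed_interval])
  qed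
  have dis: "disjoint_family_on (\<lambda>i. {s i<..t i}) {..<m}"
    unfolding disjoint_family_on_def
  using order_chain_cell_unique[OF ch] by blast
  have disB: "disjoint_family_on B {..<Suc m}"
    unfolding disjoint_family_on_def
  proof (intro ballI impI)
    fix i j assume ij: "i \<in> {..<Suc m}" "j \<in> {..<Suc m}" "i \<noteq> j"
    then have "i < m \<or> i = m" "j < m \<or> j = m" by auto
    then consider "i < m" "j < m" | "i < m" "j = m" | "i = m" "j < m" using ij(3) by blast
    then show "B i \<inter> B j = {}"
    proof cases
      case 1
      then show ?thesis using disjoint_family_onD[OF dis, of i j] ij(3) unfolding B_def by simp
    next
      case 2
      then show ?thesis unfolding B_def by auto
    next
      case 3
      then show ?thesis unfolding B_def by auto
    qed
  qed
  have "indep_vars (\<lambda>_. count_space UNIV) (\<lambda>i. count_points \<Gamma> (B i)) {..<Suc m}"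
    by (rule poisson_process_pointsD(5)[OF P _ disB]) (use B in auto)
  then have "prob (\<Inter>i\<in>{..m}. count_points \<Gamma> (B i) -` {if i < m then 1 else 0} \<inter> space N)
      = (\<Prod>i\<in>{..m}. prob (count_points \<Gamma> (B i) -` {if i < m then 1 else 0} \<inter> space N))"
    by (rule indep_varsD) auto
  also have "\<dots> = (\<Prod>i\<in>{..m}. (if i < m then measure lborel (B i) else 1) * exp (- measure lborel (B i)))"
  proof (intro prod.cong refl)
    fix i assume "i \<in> {..m}"
    then have i: "i \<le> m" by simp
    have "count_points \<Gamma> (B i) -` {if i < m then 1 else 0} \<inter> space N
        = {\<omega> \<in> space N. count_points \<Gamma> (B i) \<omega> = (if i < m then 1 else 0)}" by auto
    then show "prob (count_points \<Gamma> (B i) -` {if i < m then 1 else 0} \<inter> space N)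
        = (if i < m then measure lborel (B i) else 1) * exp (- measure lborel (B i))"
      using poisson_process_pointsD(4)[OF P B[OF i], of "if i < m then 1 else 0"] by (simp split: if_splits)
  qed
  also have "\<dots> = (\<Prod>i<m. measure lborel (B i)) * exp (- (\<Sum>i\<le>m. measure lborel (B i)))"
  proof -
    have "(\<Prod>i\<le>m. if i < m then measure lborel (B i) else 1) = (\<Prod>i<m. measure lborel (B i))"
      unfolding lessThan_Suc_atMost[symmetric] by simp
    moreover have "(\<Prod>i\<le>m. exp (- measure lborel (B i))) = exp (- (\<Sum>i\<le>m. measure lborel (B i)))"
      unfolding sum_negf[symmetric] by (simp only: exp_sum finite_atMost)
    ultimately show ?thesis unfolding prod.distrib by simp
  qed
  also have "(\<Prod>i<m. measure lborel (B i)) = (\<Prod>i<m. t i - s i)"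
    using st by (intro prod.cong) (auto simp: B_def less_imp_le)
  also have "(\<Sum>i\<le>m. measure lborel (B i)) = s m"
  proof -
    have "(\<Sum>i<Suc m. measure lborel (B i)) = measure lborel (\<Union>i<Suc m. B i)"
    proof (rule measure_finite_Union[symmetric, OF _ _ disB])
      fix i assume "i \<in> {..<Suc m}"
      then show "emeasure lborel (B i) \<noteq> \<infinity>" using B(2)[of i] emeasure_bounded_finite by force
    qed (use B in auto)
    also have "(\<Union>i<Suc m. B i) = {0..s m}"
    proof -
      have "(\<Union>i<m. B i) = (\<Union>i<m. {s i<..t i})" by (auto simp: B_def)
      then have "(\<Union>i<Suc m. B i) = (\<Union>i<m. {s i<..t i}) \<union> B m" by (auto simp: lessThan_Suc)
      then show ?thesis unfolding Bm using sub by auto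
    qed
    finally show ?thesis using spos[of m] by (simp add: lessThan_Suc_atMost)
  qed
  finally show ?thesis .
qed

lemma mono_nth_point_le_iff:
  fixes y :: "nat \<Rightarrow> real"
  assumes mono: "\<And>l. l \<ge> 1 \<Longrightarrow> y l \<le> y (Suc l)" and fin: "finite {l \<in> {1..}. y l \<le> t}"
  shows "y (Suc i) \<le> t \<longleftrightarrow> i < card {l \<in> {1..}. y l \<le> t}"
proof -
  have le: "y k \<le> y l" if "1 \<le> k" "k \<le> l" for k l
    using that(2)
  proof (induction l rule: dec_induct)
    case (step n)
    then show ?case using mono[of n] that(1) by linarith
  qed simp
  show ?thesis
  proof
    assume "y (Suc i) \<le> t"
    then have "{1..Suc i} \<subseteq> {l \<in> {1..}. y l \<le> t}" using le[of _ "Suc i"] by force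
    then have "card {1..Suc i} \<le> card {l \<in> {1..}. y l \<le> t}" by (rule card_mono[OF fin])
    then show "i < card {l \<in> {1..}. y l \<le> t}" by simp
  next
    assume i: "i < card {l \<in> {1..}. y l \<le> t}"
    show "y (Suc i) \<le> t"
    proof (rule ccontr)
      assume n: "\<not> y (Suc i) \<le> t"
      have "l \<le> i" if "y l \<le> t" for l
        using le[of "Suc i" l] n that by (intro leI notI) auto
      then have "{l \<in> {1..}. y l \<le> t} \<subseteq> {1..i}" by auto
      then have "card {l \<in> {1..}. y l \<le> t} \<le> card {1..i}" by (intro card_mono) auto
      then show False using i by simp
    qed
  qed
qed

text \<open>The map \<open>evd_g \<gamma>\<close> carries levels of the box to levels for the Poisson points, and the coordinates of
\<open>W\<close> are the ordered points seen through the inverse map.\<close>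

lemma poisson_prob_order_box:
  assumes P: "poisson_process_points N 1 \<Gamma>" and ch: "order_chain m u v"
    and u: "\<And>i. i \<le> m \<Longrightarrow> u i \<in> evd_supp \<gamma>" and v: "\<And>i. i < m \<Longrightarrow> v i \<in> evd_supp \<gamma>"
    and W: "W = (\<lambda>\<omega> j. evd_g_inv \<gamma> (\<Gamma> (Suc j) \<omega>))"
  shows "measure N {\<omega> \<in> space N. W \<omega> \<in> order_box m u v}
    = (\<Prod>i<m. evd_g \<gamma> (v i) - evd_g \<gamma> (u i)) * exp (- evd_g \<gamma> (u m))"
proof -
  interpret prob_space N by (rule poisson_process_pointsD(1)[OF P])
  define s where "s i = evd_g \<gamma> (u i)" for i
  define t where "t i = evd_g \<gamma> (v i)" for i
  have mono: "evd_g \<gamma> x \<le> evd_g \<gamma> y" if "x \<in> evd_supp \<gamma>" "y \<in> evd_supp \<gamma>" "x \<le> y" for x y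
    using evd_g_strict_mono[OF that(1,2)] that(3) by (cases "x = y") auto
  have cht: "order_chain m s t"
    unfolding order_chain_def s_def t_def
  proof (intro allI impI conjI)
    fix i assume i: "i < m"
    have uv: "u i < v i" "v i \<le> u (Suc i)" using ch i unfolding order_chain_def by auto
    show "evd_g \<gamma> (u i) < evd_g \<gamma> (v i)" using i by (intro evd_g_strict_mono u v uv) auto
    show "evd_g \<gamma> (v i) \<le> evd_g \<gamma> (u (Suc i))" using i by (intro mono u v uv) auto
  qed
  have s0: "s 0 \<ge> 0" unfolding s_def using evd_g_pos[OF u[of 0]] by simp
  define B where "B i = (if i < m then {s i<..t i} else {0..s m} - (\<Union>i<m. {s i<..t i}))" for i
  let ?E = "\<Inter>i\<in>{..m}. count_points \<Gamma> (B i) -` {if i < m then 1 else 0} \<inter> space N"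
  have "\<Gamma> (Suc j) \<in> borel_measurable N" for j using poisson_process_pointsD(2)[OF P] by simp
  then have [measurable]: "W \<in> borel_measurable N"
    unfolding W by (intro measurable_coordinatewise_then_product measurable_compose[OF _ evd_g_inv_measurable])
  have "prob {\<omega> \<in> space N. W \<omega> \<in> order_box m u v} = prob ?E"
  proof (rule finite_measure_eq_AE)
    show "AE \<omega> in N. \<omega> \<in> {\<omega> \<in> space N. W \<omega> \<in> order_box m u v} \<longleftrightarrow> \<omega> \<in> ?E"
      using poisson_points_strictly_increasing[OF P] poisson_process_pointsD(3)[OF P] AE_space
    proof eventually_elim
      case (elim \<omega>)
      let ?c = "\<lambda>t. card {l \<in> {1..}. \<Gamma> l \<omega> \<le> t}"
      have fin: "finite {l \<in> {1..}. \<Gamma> l \<omega> \<le> x}" for x using elim(2) by simp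
      have c: "\<Gamma> (Suc i) \<omega> \<le> x \<longleftrightarrow> i < ?c x" for i x
        by (rule mono_nth_point_le_iff[OF _ fin]) (use elim(1) in \<open>auto intro: less_imp_le\<close>)
      have le: "W \<omega> i \<le> x \<longleftrightarrow> i < ?c (evd_g \<gamma> x)" if "x \<in> evd_supp \<gamma>" for i x
        unfolding W c[symmetric] using elim(1) that by (intro evd_g_inv_le_iff) auto
      have "W \<omega> \<in> order_box m u v \<longleftrightarrow> (\<forall>i\<le>m. ?c (s i) \<le> i) \<and> (\<forall>i<m. i < ?c (t i))"
        unfolding order_box_def mem_Collect_eq not_le[symmetric] s_def t_def
        using le u v by (auto simp: not_less)
      also have "\<dots> \<longleftrightarrow> (\<forall>i<m. card {l \<in> {1..}. \<Gamma> l \<omega> \<in> {s i<..t i}} = 1) \<and>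
          {l \<in> {1..}. \<Gamma> l \<omega> \<le> s m \<and> (\<forall>i<m. \<Gamma> l \<omega> \<notin> {s i<..t i})} = {}"
        by (rule order_chain_cells[OF cht fin])
      also have "(\<forall>i<m. card {l \<in> {1..}. \<Gamma> l \<omega> \<in> {s i<..t i}} = 1)
          \<longleftrightarrow> (\<forall>i<m. count_points \<Gamma> (B i) \<omega> = 1)"
        unfolding count_points_def B_def by simp
      also have "{l \<in> {1..}. \<Gamma> l \<omega> \<le> s m \<and> (\<forall>i<m. \<Gamma> l \<omega> \<notin> {s i<..t i})} = {l. 1 \<le> l \<and> \<Gamma> l \<omega> \<in> B m}"
        using elim(2) unfolding B_def by auto
      also have "{l. 1 \<le> l \<and> \<Gamma> l \<omega> \<in> B m} = {} \<longleftrightarrow> count_points \<Gamma> (B m) \<omega> = 0"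
      proof -
        have "finite {l. 1 \<le> l \<and> \<Gamma> l \<omega> \<in> B m}"
          by (rule finite_subset[OF _ fin[of "s m"]]) (auto simp: B_def)
        then show ?thesis unfolding count_points_def by simp
      qed
      also have "(\<forall>i<m. count_points \<Gamma> (B i) \<omega> = 1) \<and> count_points \<Gamma> (B m) \<omega> = 0 \<longleftrightarrow>
          (\<forall>i\<le>m. count_points \<Gamma> (B i) \<omega> = (if i < m then 1 else 0))"
        by (auto simp: le_less)
      finally show ?case using elim(3) by auto
    qed
    have "{\<omega> \<in> space N. W \<omega> \<in> order_box m u v} = W -` order_box m u v \<inter> space N" by auto
    then show "{\<omega> \<in> space N. W \<omega> \<in> order_box m u v} \<in> events"
      by (simp add: measurable_sets[OF _ order_box_borel])
    note order_chain_le_last[OF cht]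
    moreover have "0 \<le> s i" if "i \<le> m" for i using order_chain_mono[OF cht, of 0 i] s0 that by simp
    ultimately have Bs: "B i \<subseteq> {0..s m}" if "i \<le> m" for i
      using that unfolding B_def by (auto split: if_splits) (meson less_imp_le order_trans)+
    have Bb: "B i \<in> sets borel" for i unfolding B_def by auto
    show "?E \<in> events"
    proof (intro sets.finite_INT)
      fix i assume "i \<in> {..m}"
      then have "bounded (B i)" "B i \<subseteq> {0..}"
        using Bs[of i] bounded_subset[OF bounded_closed_interval] by auto
      from count_points_measurable[OF P Bb this]
      show "count_points \<Gamma> (B i) -` {if i < m then 1 else 0} \<inter> space N \<in> events"
        by (rule measurable_sets) simp
    qed auto
  qed
  also have "\<dots> = (\<Prod>i<m. t i - s i) * exp (- s m)"
    using poisson_prob_one_point_per_cell[OF P cht s0] unfolding B_def .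
  finally show ?thesis unfolding s_def t_def .
qed

section \<open>Convergence of the box probabilities\<close>

text \<open>With \<open>h = - ln (1 - F)\<close> the hypothesis reads \<open>r h \<longlonglongrightarrow> l\<close>, so \<open>h \<longlonglongrightarrow> 0\<close>. The second limit is then
\<open>(1 - F)^r = exp (- r h)\<close>, and the first follows from \<open>h / (1 + h) \<le> 1 - exp (- h) \<le> h\<close>. A finite limit
excludes \<open>F (t r) = 1\<close> for large \<open>r\<close>.\<close>

lemma tail_limits_of_cum_hazard:
  assumes F: "\<And>x. 0 \<le> F x" "\<And>x. F x \<le> 1"
    and lim: "(\<lambda>r. ereal (real r) * cum_hazard F (t r)) \<longlonglongrightarrow> ereal l"
  shows "(\<lambda>r. real r * F (t r)) \<longlonglongrightarrow> l" "(\<lambda>r. (1 - F (t r)) ^ r) \<longlonglongrightarrow> exp (- l)"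
proof -
  have "\<forall>\<^sub>F r in sequentially. ereal (real r) * cum_hazard F (t r) < \<infinity>"
    using lim by (intro order_tendstoD(2)) auto
  then have ne: "\<forall>\<^sub>F r in sequentially. r > 0 \<and> F (t r) < 1"
    using eventually_gt_at_top[of 0]
  proof eventually_elim
    case (elim r)
    then show ?case using F(2)[of "t r"] by (cases "F (t r) = 1") (auto simp: cum_hazard_def)
  qed
  define h where "h r = - ln (1 - F (t r))" for r
  have h0: "h r \<ge> 0" for r unfolding h_def using F[of "t r"] by (cases "F (t r) = 1") auto
  have "\<forall>\<^sub>F r in sequentially. ereal (real r) * cum_hazard F (t r) = ereal (real r * h r)"
    using ne by eventually_elim (simp add: cum_hazard_def h_def)
  then have "(\<lambda>r. ereal (real r * h r)) \<longlonglongrightarrow> ereal l" by (rule Lim_transform_eventually[OF lim])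
  then have rh: "(\<lambda>r. real r * h r) \<longlonglongrightarrow> l" by simp
  have eF: "1 - F (t r) = exp (- h r)" if "F (t r) < 1" for r using that by (simp add: h_def)
  have "(\<lambda>r. exp (- (real r * h r))) \<longlonglongrightarrow> exp (- l)" by (intro tendsto_intros rh)
  moreover have "\<forall>\<^sub>F r in sequentially. exp (- (real r * h r)) = (1 - F (t r)) ^ r"
    using ne by eventually_elim (simp add: eF exp_of_nat_mult[symmetric])
  ultimately show "(\<lambda>r. (1 - F (t r)) ^ r) \<longlonglongrightarrow> exp (- l)" by (rule Lim_transform_eventually)
  have "(\<lambda>r. (real r * h r) * (1 / real r)) \<longlonglongrightarrow> l * 0" by (intro tendsto_mult rh lim_1_over_n)
  moreover have "\<forall>\<^sub>F r in sequentially. (real r * h r) * (1 / real r) = h r"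
    using ne by eventually_elim simp
  ultimately have hlim: "h \<longlonglongrightarrow> 0" by (simp add: Lim_transform_eventually)
  show "(\<lambda>r. real r * F (t r)) \<longlonglongrightarrow> l"
  proof (rule tendsto_sandwich)
    have "(\<lambda>r. (real r * h r) / (1 + h r)) \<longlonglongrightarrow> l / (1 + 0)" by (intro tendsto_intros rh hlim) simp
    then show "(\<lambda>r. (real r * h r) / (1 + h r)) \<longlonglongrightarrow> l" by simp
    show "\<forall>\<^sub>F r in sequentially. (real r * h r) / (1 + h r) \<le> real r * F (t r)"
      using ne
    proof eventually_elim
      case (elim r)
      have "1 + h r \<le> exp (h r)" by (rule exp_ge_add_one_self)
      then have "exp (- h r) \<le> 1 / (1 + h r)"
        using h0[of r] by (simp add: exp_minus inverse_eq_divide frac_le)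
      moreover have "h r / (1 + h r) = 1 - 1 / (1 + h r)" using h0[of r] by (simp add: field_simps)
      ultimately have "h r / (1 + h r) \<le> F (t r)" using eF[of r] elim by linarith
      then have "real r * (h r / (1 + h r)) \<le> real r * F (t r)" by (rule mult_left_mono) simp
      then show ?case by simp
    qed
    show "\<forall>\<^sub>F r in sequentially. real r * F (t r) \<le> real r * h r"
      using ne
    proof eventually_elim
      case (elim r)
      have "1 - h r \<le> exp (- h r)" using exp_ge_add_one_self[of "- h r"] by simp
      then show ?case using eF[of r] elim by (intro mult_left_mono) auto
    qed
  qed (rule rh)
qed

text \<open>Distribute \<open>r^m\<close> over the product: each \<open>(r - i) / r\<close> tends to 1, each \<open>r * p r i\<close> to its limit, and
\<open>q r ^ r / q r ^ m\<close> to \<open>L\<close>. This is the passage from multinomial to Poisson probabilities.\<close>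

lemma falling_factorial_asymp:
  fixes p :: "nat \<Rightarrow> nat \<Rightarrow> real" and q :: "nat \<Rightarrow> real"
  assumes p: "\<And>i. i < m \<Longrightarrow> (\<lambda>r. real r * p r i) \<longlonglongrightarrow> l i"
    and q: "(\<lambda>r. q r ^ r) \<longlonglongrightarrow> L" "q \<longlonglongrightarrow> 1"
  shows "(\<lambda>r. (\<Prod>i<m. real r - real i) * ((\<Prod>i<m. p r i) * q r ^ (r - m))) \<longlonglongrightarrow> (\<Prod>i<m. l i) * L"
proof -
  have "(\<lambda>r. (\<Prod>i<m. 1 - real i * (1 / real r)) * ((\<Prod>i<m. real r * p r i) * (q r ^ r / q r ^ m)))
      \<longlonglongrightarrow> (\<Prod>i<m. 1 - real i * 0) * ((\<Prod>i<m. l i) * (L / 1 ^ m))"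
    by (intro tendsto_mult tendsto_prod tendsto_diff tendsto_const lim_1_over_n p tendsto_divide tendsto_power q)
      auto
  moreover have "\<forall>\<^sub>F r in sequentially. (\<Prod>i<m. 1 - real i * (1 / real r)) * ((\<Prod>i<m. real r * p r i) * (q r ^ r / q r ^ m))
      = (\<Prod>i<m. real r - real i) * ((\<Prod>i<m. p r i) * q r ^ (r - m))"
    using eventually_ge_at_top[of "max 1 m"] order_tendstoD(1)[OF q(2), of 0, simplified]
  proof eventually_elim
    case (elim r)
    have "(\<Prod>i<m. 1 - real i * (1 / real r)) * (\<Prod>i<m. real r * p r i)
        = (\<Prod>i<m. real r - real i) * (\<Prod>i<m. p r i)"
      unfolding prod.distrib[symmetric] using elim by (intro prod.cong) (auto simp: field_simps)
    moreover have "q r ^ r / q r ^ m = q r ^ (r - m)" using elim by (simp add: power_diff)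
    ultimately show ?case by (metis mult.assoc)
  qed
  ultimately show ?thesis by (simp add: Lim_transform_eventually)
qed

section \<open>Weak convergence of the order statistics\<close>

theorem proposition3p4:
  fixes M :: "'a measure" and N :: "'b measure"
    and X :: "nat \<Rightarrow> 'a \<Rightarrow> real" and F :: "real \<Rightarrow> real"
    and a b :: "nat \<Rightarrow> real" and \<gamma> :: real
    and \<Gamma> :: "nat \<Rightarrow> 'b \<Rightarrow> real"
  assumes "prob_space M"
    and indep: "prob_space.indep_vars M (\<lambda>_. borel) X {1..}"
    and cdf: "\<And>i. i \<ge> 1 \<Longrightarrow> cdf (distr M borel (X i)) = F"
    and cont: "continuous_on UNIV F"
    and a_pos: "\<And>r. r \<ge> 1 \<Longrightarrow> a r > 0"
    and doa: "\<And>x. x \<in> evd_supp \<gamma> \<Longrightarrow>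
          (\<lambda>r. ereal (real r) * cum_hazard F (a r * x - b r)) \<longlonglongrightarrow> ereal (evd_g \<gamma> x)"
    and poisson: "poisson_process_points N 1 \<Gamma>"
  shows "weak_conv_borel
           (\<lambda>r. distr M borel (\<lambda>\<omega> (j::nat). (rth_largest X r (r + j) \<omega> + b r) / a r))
           (distr N borel (\<lambda>\<omega> (j::nat). evd_g_inv \<gamma> (\<Gamma> (Suc j) \<omega>)))"
proof -
  interpret prob_space M by fact
  interpret N: prob_space N by (rule poisson_process_pointsD(1)[OF poisson])
  define Z where "Z r = (\<lambda>\<omega> (j::nat). (rth_largest X r (r + j) \<omega> + b r) / a r)" for r
  define W where "W = (\<lambda>\<omega> (j::nat). evd_g_inv \<gamma> (\<Gamma> (Suc j) \<omega>))"
  have rv: "random_variable borel (X k)" if "k \<ge> 1" for k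
    using indep that by (auto simp: indep_vars_def)
  have Zm: "Z r \<in> borel_measurable M" if "r \<ge> 1" for r
  proof -
    note [measurable] = rth_largest_measurable[OF rv that]
    show ?thesis unfolding Z_def by (rule measurable_coordinatewise_then_product) measurable
  qed
  have "\<Gamma> (Suc j) \<in> borel_measurable N" for j using poisson_process_pointsD(2)[OF poisson] by simp
  then have Wm: "W \<in> borel_measurable N"
    unfolding W_def by (intro measurable_coordinatewise_then_product measurable_compose[OF _ evd_g_inv_measurable])
  have F: "0 \<le> F x" "F x \<le> 1" for x
  proof -
    interpret D: real_distribution "distr M borel (X 1)" using rv[of 1] by (intro real_distribution_distr) simp
    show "0 \<le> F x" "F x \<le> 1"
      using D.cdf_nonneg[of x] D.cdf_bounded_prob[of x] cdf[of 1] by auto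
  qed
  have rF: "(\<lambda>r. real r * F (a r * x - b r)) \<longlonglongrightarrow> evd_g \<gamma> x"
    and qr: "(\<lambda>r. (1 - F (a r * x - b r)) ^ r) \<longlonglongrightarrow> exp (- evd_g \<gamma> x)" if "x \<in> evd_supp \<gamma>" for x
    using tail_limits_of_cum_hazard[OF F doa[OF that]] by auto
  have F0: "(\<lambda>r. F (a r * x - b r)) \<longlonglongrightarrow> 0" if "x \<in> evd_supp \<gamma>" for x
  proof -
    have "(\<lambda>r. (real r * F (a r * x - b r)) * (1 / real r)) \<longlonglongrightarrow> evd_g \<gamma> x * 0"
      by (intro tendsto_mult rF that lim_1_over_n)
    moreover have "\<forall>\<^sub>F r in sequentially. (real r * F (a r * x - b r)) * (1 / real r) = F (a r * x - b r)"
      using eventually_gt_at_top[of 0] by eventually_elim simp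
    ultimately show ?thesis by (simp add: Lim_transform_eventually)
  qed
  let ?\<mu> = "\<lambda>r. distr M borel (Z r)" and ?\<nu> = "distr N borel W"
  \<comment> \<open>the empty set makes the class of boxes stable under intersections\<close>
  let ?\<A> = "insert {} (order_boxes (evd_supp \<gamma>))"
  have lim: "(\<lambda>r. measure (?\<mu> r) (order_box m u v)) \<longlonglongrightarrow> measure ?\<nu> (order_box m u v)"
    if ch: "order_chain m u v" and u: "\<And>i. i \<le> m \<Longrightarrow> u i \<in> evd_supp \<gamma>"
      and v: "\<And>i. i < m \<Longrightarrow> v i \<in> evd_supp \<gamma>" for m u v
  proof -
    define U where "U r i = a r * u i - b r" for r i
    define V where "V r i = a r * v i - b r" for r i
    define p where "p r = (\<Prod>i<m. real r - real i) *
      ((\<Prod>i<m. F (V r i) - F (U r i)) * (1 - F (U r m)) ^ (r - m))" for r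
    have \<nu>: "measure ?\<nu> (order_box m u v) = (\<Prod>i<m. evd_g \<gamma> (v i) - evd_g \<gamma> (u i)) * exp (- evd_g \<gamma> (u m))"
    proof -
      have "W -` order_box m u v \<inter> space N = {\<omega> \<in> space N. W \<omega> \<in> order_box m u v}" by auto
      then show ?thesis
        using poisson_prob_order_box[OF poisson ch u v W_def] by (simp add: measure_distr[OF Wm order_box_borel])
    qed
    have p: "p \<longlonglongrightarrow> measure ?\<nu> (order_box m u v)"
      unfolding \<nu> p_def
    proof (rule falling_factorial_asymp)
      show "(\<lambda>r. real r * (F (V r i) - F (U r i))) \<longlonglongrightarrow> evd_g \<gamma> (v i) - evd_g \<gamma> (u i)" if "i < m" for i
        unfolding right_diff_distrib U_def V_def using that by (intro tendsto_diff rF u v) auto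
      show "(\<lambda>r. (1 - F (U r m)) ^ r) \<longlonglongrightarrow> exp (- evd_g \<gamma> (u m))"
        unfolding U_def by (intro qr u) simp
      show "(\<lambda>r. 1 - F (U r m)) \<longlonglongrightarrow> 1"
        using tendsto_diff[OF tendsto_const[of 1] F0[OF u[of m]]] unfolding U_def by simp
    qed
    have near: "\<forall>\<^sub>F r in sequentially. norm (measure (?\<mu> r) (order_box m u v) - p r) \<le> real m * F (U r m)"
      using eventually_ge_at_top[of "max 1 m"]
    proof eventually_elim
      case (elim r)
      then have r: "r \<ge> 1" "m \<le> r" "a r > 0" using a_pos by auto
      have chr: "order_chain m (U r) (V r)"
        using ch r unfolding order_chain_def U_def V_def by auto
      have sc: "(x + b r) / a r \<le> y \<longleftrightarrow> x \<le> a r * y - b r" "y < (x + b r) / a r \<longleftrightarrow> a r * y - b r < x" for x y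
        using r by (auto simp: field_simps)
      have "Z r -` order_box m u v \<inter> space M
          = {\<omega> \<in> space M. (\<lambda>j. rth_largest X r (r + j) \<omega>) \<in> order_box m (U r) (V r)}"
        unfolding Z_def order_box_def U_def V_def by (auto simp: sc)
      then have "measure (?\<mu> r) (order_box m u v)
          = prob {\<omega> \<in> space M. (\<lambda>j. rth_largest X r (r + j) \<omega>) \<in> order_box m (U r) (V r)}"
        by (simp add: measure_distr[OF Zm[OF r(1)] order_box_borel])
      then show ?case
        using prob_sample_order_box_approx[OF indep cdf chr r(2,1)] unfolding p_def by simp
    qed
    have "(\<lambda>r. real m * F (U r m)) \<longlonglongrightarrow> real m * 0"
      unfolding U_def by (intro tendsto_mult tendsto_const F0 u) simp
    then have "(\<lambda>r. measure (?\<mu> r) (order_box m u v) - p r) \<longlonglongrightarrow> 0"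
      by (intro Lim_null_comparison[OF near]) simp
    from tendsto_add[OF this p] show ?thesis by simp
  qed
  have "weak_conv_borel ?\<mu> ?\<nu>"
  proof (rule weak_conv_borel_Int_stable_local_base)
    \<comment> \<open>for \<open>r = 0\<close> there is no \<open>r\<close>-th largest value; the law has a meaning only from \<open>r = 1\<close> on\<close>
    show "\<forall>\<^sub>F r in sequentially. prob_space (?\<mu> r)"
      using eventually_ge_at_top[of 1] by eventually_elim (intro prob_space_distr Zm)
    show "prob_space ?\<nu>" by (intro N.prob_space_distr Wm)
    show "\<forall>A\<in>?\<A>. A \<in> sets borel \<and> (\<lambda>r. measure (?\<mu> r) A) \<longlonglongrightarrow> measure ?\<nu> A"
      using order_box_borel lim unfolding order_boxes_def by auto
    show "\<forall>A\<in>?\<A>. \<forall>B\<in>?\<A>. A \<inter> B \<in> ?\<A>"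
      using order_boxes_Int by blast
    have "AE z in ?\<nu>. (\<forall>i. z i < z (Suc i)) \<and> (\<forall>i. z i \<in> evd_supp \<gamma>)"
    proof (subst AE_distr_iff[OF Wm])
      have [measurable]: "(\<lambda>z::nat \<Rightarrow> real. z i) \<in> borel_measurable borel" for i
        by (rule borel_measurable_continuous_onI) simp
      have [measurable]: "evd_supp \<gamma> \<in> sets borel" using open_evd_supp by simp
      show "{z \<in> space borel. (\<forall>i. z i < z (Suc i)) \<and> (\<forall>i. z i \<in> evd_supp \<gamma>)} \<in> sets borel"
        by measurable
      show "AE \<omega> in N. (\<forall>i. W \<omega> i < W \<omega> (Suc i)) \<and> (\<forall>i. W \<omega> i \<in> evd_supp \<gamma>)"
        using poisson_points_strictly_increasing[OF poisson]
        by eventually_elim (auto simp: W_def intro: evd_g_inv evd_g_inv_strict_mono)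
    qed
    then show "AE z in ?\<nu>. \<forall>U. open U \<and> z \<in> U \<longrightarrow> (\<exists>A\<in>?\<A>. z \<in> interior A \<and> A \<subseteq> U)"
    proof eventually_elim
      case (elim z)
      then have "strict_mono z" by (simp add: strict_mono_Suc_iff)
      then show ?case
        using order_boxes_local_base[OF open_evd_supp convex_evd_supp, of z \<gamma>] elim by blast
    qed
  qed simp_all
  then show ?thesis unfolding Z_def W_def .
qed

end
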